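(* Let $\lambda>0$, $\eta\in\mathbb{R}$, $b=\lambda+i\eta$, let $n\ge1$, and let $x_{n,1}^{(\eta,\lambda)}<\cdots<x_{n,n}^{(\eta,\lambda)}$ be the zeros of the complementary Romanovski-Routh polynomial $\mathcal{P}_n(b;x)$. Let $h_{n,k}$ and $l_{n,k}^{(2\lambda-1)}$ be the $k$-th zeros (in increasing order) of the Hermite polynomial $H_n(x)$ and the Laguerre polynomial $L_n^{(2\lambda-1)}(x)$, respectively. Then, for each $k=1,\ldots,n$, $$x_{n,k}^{(\eta,\lambda)}=\frac{h_{n,k}}{\sqrt{\lambda}}+\frac{\eta}{\lambda}+\mathcal{O}\big((1/\sqrt{\lambda})^3\big)\quad\text{as }\lambda\to\infty,$$ and $$x_{n,k}^{(\eta,\lambda)}=\frac{2\eta}{l_{n,n+1-k}^{(2\lambda-1)}}+\mathcal{O}(1/\eta)\quad\text{as }\eta\to\infty.$$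
   Context: For $b=\lambda+i\eta$ with $\lambda>0$, $\eta\in\mathbb{R}$, the complementary Romanovski-Routh (CRR) polynomials are $\mathcal{P}_n(b;x)=\frac{(2\lambda)_n}{2^n(\lambda)_n}(x-i)^n\,{}_2F_1\!\left(-n,b;b+\overline{b};\frac{-2i}{x-i}\right)$, $n\ge0$, where $(\alpha)_n=\alpha(\alpha+1)\cdots(\alpha+n-1)$. Equivalently, $\mathcal{P}_0(b;x)=1$, $\mathcal{P}_1(b;x)=x-c_1^{(b)}$, and $\mathcal{P}_{n+1}(b;x)=(x-c_{n+1}^{(b)})\mathcal{P}_n(b;x)-d_{n+1}^{(\lambda)}(x^2+1)\mathcal{P}_{n-1}(b;x)$ for $n\ge1$, where $c_n^{(b)}=\frac{\eta}{\lambda+n-1}$ and $d_{n+1}^{(\lambda)}=\frac14\frac{n(n+2\lambda-1)}{(n+\lambda-1)(n+\lambda)}$, $n\ge1$. It is known that $\mathcal{P}_n(b;x)$ has $n$ real simple zeros. $H_n$ are the Hermite polynomials, orthogonal on $(-\infty,\infty)$ with respect to $e^{-x^2}$; $L_n^{(\alpha)}$ are the Laguerre polynomials, orthogonal on $(0,\infty)$ with respect to $x^{\alpha}e^{-x}$. In the first formula $n,k,\eta$ are fixed; in the second $n,k,\lambda$ are fixed. The symbol $\mathcal{O}(h^m)$ means powers of $h$ greater than or equal to $m$ (with $h=1/\sqrt{\lambda}$, respectively $h=1/\eta$, and coefficients independent of $h$). *)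

theory Defs
  imports
    "HOL-Analysis.Analysis"
    "HOL-Computational_Algebra.Computational_Algebra"
    "HOL-Library.Landau_Symbols"
begin

text \<open>
  The Gauss hypergeometric series. It is only used below with \<open>a = -n\<close>, where it
  terminates, so that no convergence question arises.
\<close>

definition hyp2F1 :: "complex \<Rightarrow> complex \<Rightarrow> complex \<Rightarrow> complex \<Rightarrow> complex" where
  "hyp2F1 a b c z = eval_fps (fps_hypergeo [a, b] [c] 1) z"

text \<open>
  The complementary Romanovski-Routh polynomial as a function of a real variable. All zeros of
  the polynomial are real, and for real \<open>x\<close> the quotient by \<open>x - \<i>\<close> is harmless. The values
  are real numbers, represented in type \<^typ>\<open>complex\<close>.
\<close>

definition CRR :: "complex \<Rightarrow> nat \<Rightarrow> real \<Rightarrow> complex" where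
  "CRR b n x =
     of_real (pochhammer (2 * Re b) n / (2 ^ n * pochhammer (Re b) n)) *
     (of_real x - \<i>) ^ n *
     hyp2F1 (- of_nat n) b (b + cnj b) (- 2 * \<i> / (of_real x - \<i>))"

text \<open>The Hermite polynomials for the weight \<open>exp (- x\<^sup>2)\<close>, with leading coefficient \<open>2 ^ n\<close>.\<close>

fun hermite :: "nat \<Rightarrow> real poly" where
  "hermite 0 = 1"
| "hermite (Suc 0) = [:0, 2:]"
| "hermite (Suc (Suc n)) = [:0, 2:] * hermite (Suc n) - smult (2 * of_nat (Suc n)) (hermite n)"

text \<open>The Laguerre polynomials for the weight \<open>x powr \<alpha> * exp (- x)\<close> on \<open>x > 0\<close>, \<open>\<alpha> > -1\<close>.\<close>

definition laguerre :: "real \<Rightarrow> nat \<Rightarrow> real poly" where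
  "laguerre \<alpha> n =
     (\<Sum>j\<le>n. monom ((-1) ^ j * ((of_nat n + \<alpha>) gchoose (n - j)) / fact j) j)"

text \<open>The zeros of \<open>f\<close> on the real line are counted from \<open>k = 1\<close> in increasing order.\<close>

definition kth_zero :: "(real \<Rightarrow> 'a::zero) \<Rightarrow> nat \<Rightarrow> real" where
  "kth_zero f k = sorted_list_of_set {x. f x = 0} ! (k - 1)"

text \<open>
  The remainder \<open>\<O>(h\<^sup>m)\<close> in the sense of a series in powers of \<open>h\<close> with exponents at least \<open>m\<close>:
  along the filter \<open>F\<close>, \<open>f\<close> is the sum of a convergent power series in \<open>h\<close> that
  starts with \<open>h\<^sup>m\<close> and whose coefficients do not depend on the point.
  By \<open>powers_from_imp_bigo\<close> this entails the estimate \<open>f \<in> O[F](h\<^sup>m)\<close> when \<open>h\<close> tends to \<open>0\<close>.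
\<close>

definition powers_from :: "nat \<Rightarrow> ('a \<Rightarrow> real) \<Rightarrow> 'a filter \<Rightarrow> ('a \<Rightarrow> real) \<Rightarrow> bool" where
  "powers_from m h F f \<longleftrightarrow>
     (\<exists>a :: nat \<Rightarrow> real. \<forall>\<^sub>F t in F. (\<lambda>j. a j * h t ^ (m + j)) sums f t)"

lemma powers_from_imp_bigo:
  assumes f: "powers_from m h F f" and h0: "(h \<longlongrightarrow> 0) F"
    and hnz: "\<forall>\<^sub>F t in F. h t \<noteq> 0"
  shows "f \<in> O[F](\<lambda>t. h t ^ m)"
proof (cases "F = bot")
  case True
  then show ?thesis by (intro bigoI[of _ 1]) simp
next
  case False
  obtain a where a: "\<forall>\<^sub>F t in F. (\<lambda>j. a j * h t ^ (m + j)) sums f t"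
    using f unfolding powers_from_def by blast
  have smb: "summable (\<lambda>j. a j * x ^ j)" if "x \<noteq> 0" "(\<lambda>j. a j * x ^ (m + j)) sums s" for x s :: real
  proof -
    have "summable (\<lambda>j. x ^ m * (a j * x ^ j))"
      using that(2) by (auto simp: sums_iff power_add mult_ac)
    then show ?thesis using that(1) by (simp add: summable_cmult_iff)
  qed
  obtain t0 where t0: "h t0 \<noteq> 0" "(\<lambda>j. a j * h t0 ^ (m + j)) sums f t0"
    using eventually_happens'[OF False eventually_conj[OF hnz a]] by blast
  define r where "r = \<bar>h t0\<bar> / 2"
  have r: "r > 0" "r < \<bar>h t0\<bar>" using t0 by (auto simp: r_def)
  have sr: "summable (\<lambda>j. norm (a j * r ^ j))"
    by (rule powser_insidea[OF smb[OF t0]]) (use r in auto)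
  define C where "C = (\<Sum>j. norm (a j * r ^ j))"
  have "\<forall>\<^sub>F t in F. \<bar>h t\<bar> < r"
    using tendstoD[OF h0 r(1)] by (simp add: dist_real_def)
  with a hnz have "\<forall>\<^sub>F t in F. norm (f t) \<le> C * norm (h t ^ m)"
  proof eventually_elim
    case (elim t)
    let ?g = "\<lambda>j. a j * h t ^ j"
    have le: "norm (?g j) \<le> norm (a j * r ^ j)" for j
      using elim r by (auto simp: abs_mult power_abs intro!: mult_left_mono power_mono)
    have "norm (suminf ?g) \<le> C"
      unfolding C_def by (rule norm_suminf_le[OF le sr])
    moreover have "f t = h t ^ m * suminf ?g"
    proof -
      have "(\<lambda>j. h t ^ m * ?g j) sums (h t ^ m * suminf ?g)"
        using smb[of "h t"] elim by (intro sums_mult summable_sums) auto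
      then show ?thesis using elim(1) by (auto simp: power_add mult_ac sums_iff)
    qed
    ultimately show ?case
      by (simp add: abs_mult mult.commute[of C] mult_left_mono)
  qed
  then show ?thesis by (rule bigoI)
qed

end

theory Submission
  imports Defs "HOL-Complex_Analysis.Complex_Analysis"
begin

text \<open>
  Up to a positive factor that depends only on \<open>n\<close> and \<open>\<lambda>\<close>, the polynomial \<open>\<P>\<^sub>n(b;x)\<close> is a continuant,
  that is, it is produced by a three-term recurrence, with coefficients
  \<open>2(m + \<lambda>)x - 2\<eta>\<close> and \<open>m(m - 1 + 2\<lambda>)(x\<^sup>2 + 1)\<close> (\<open>CRR_eq_continuant\<close>). Two facts become visible
  in this form: the values at real points are real, and a rescaling of \<open>x\<close> can be carried out
  inside the coefficients.

  For \<open>\<lambda> = 1/h\<^sup>2\<close> and \<open>x = h(y + \<eta>h)\<close> the rescaled coefficients are polynomials in \<open>h\<close> and \<open>y\<close>. At \<open>h = 0\<close>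
  they are those of the Hermite recurrence, and they contain no term that is linear in \<open>h\<close>.
  For \<open>\<eta> = 1/h\<close> and \<open>x = u/h\<close> they are polynomials in \<open>h\<^sup>2\<close> and \<open>u\<close>, and at \<open>h = 0\<close> the continuant
  is \<open>u\<^sup>n\<close> times the Laguerre polynomial at \<open>2/u\<close>, up to a constant. In both cases the zeros
  of the CRR polynomial become the zeros of a polynomial of degree at most \<open>n\<close> whose coefficients are
  polynomials in \<open>h\<close>, whose value at \<open>h = 0\<close> has \<open>n\<close> distinct real zeros and whose first derivative with
  respect to \<open>h\<close> vanishes at \<open>h = 0\<close>.

  Under these conditions every zero \<open>y\<^sub>k(h)\<close> is an analytic function
  \<open>y\<^sub>k(0) + a\<^sub>2 h\<^sup>2 + a\<^sub>3 h\<^sup>3 + \<dots>\<close> (\<open>kth_zero_perturbation\<close>): simple zeros persist by the holomorphic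
  implicit function theorem, their order persists by continuity, the degree leaves no room for
  further zeros, and the linear term is minus the quotient of the derivative in \<open>h\<close> by the
  derivative in \<open>y\<close>. Undoing the substitution multiplies the remainder by \<open>h\<close>
  or by \<open>1/h\<close>, which gives powers from \<open>h\<^sup>3\<close> and from \<open>h\<close> on, respectively.

  The limit polynomials have the required real zeros because consecutive continuants with
  increasing linear \<open>a m\<close> and positive constant \<open>b m\<close> interlace (\<open>card_roots_continuant\<close>).
\<close>

section \<open>Three-term recurrences\<close>

text \<open>
  The indices are shifted so that \<open>a m\<close> and \<open>b m\<close> are the coefficients of the step from \<open>m\<close> to \<open>m + 1\<close>.
  The ring is left general: the same recurrence is read over polynomials, reals and
  complex numbers.
\<close>

fun continuant :: "(nat \<Rightarrow> 'a::comm_ring_1) \<Rightarrow> (nat \<Rightarrow> 'a) \<Rightarrow> nat \<Rightarrow> 'a" where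
  "continuant a b 0 = 1"
| "continuant a b (Suc 0) = a 0"
| "continuant a b (Suc (Suc m)) =
     a (Suc m) * continuant a b (Suc m) - b (Suc m) * continuant a b m"

lemma continuant_eqI:
  assumes "f 0 = 1" "f (Suc 0) = a 0"
    "\<And>m. f (Suc (Suc m)) = a (Suc m) * f (Suc m) - b (Suc m) * f m"
  shows "continuant a b n = f n"
  using assms by (induction a b n rule: continuant.induct) auto

text \<open>
  A step of the recurrence raises the degree by one, and \<open>b m\<close> accompanies two steps. This is what lets
  a rescaling of the variable be absorbed into the coefficients.
\<close>

lemma continuant_scale:
  "continuant (\<lambda>m. c * a m) (\<lambda>m. c\<^sup>2 * b m) n = c ^ n * continuant a b n"
  by (induction a b n rule: continuant.induct) (auto simp: algebra_simps power2_eq_square)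

lemma continuant_of_real:
  "(of_real (continuant a b n) :: 'a :: {real_algebra_1, comm_ring_1}) =
     continuant (\<lambda>m. of_real (a m)) (\<lambda>m. of_real (b m)) n"
  by (induction a b n rule: continuant.induct) auto

lemma continuant_cnj:
  "cnj (continuant a b n) = continuant (\<lambda>m. cnj (a m)) (\<lambda>m. cnj (b m)) n"
  by (induction a b n rule: continuant.induct) auto

lemma poly_continuant:
  "poly (continuant a b n) x = continuant (\<lambda>m. poly (a m) x) (\<lambda>m. poly (b m) x) n"
  by (induction a b n rule: continuant.induct) auto

lemma degree_continuant_le:
  assumes "\<And>m. degree (a m) \<le> 1" "\<And>m. degree (b m) \<le> 2"
  shows "degree (continuant a b n) \<le> n"
proof (induction n rule: induct_nat_012)
  case (ge2 n)
  have "degree (a (Suc n) * continuant a b (Suc n)) \<le> Suc (Suc n)"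
    using degree_mult_le[of "a (Suc n)" "continuant a b (Suc n)"] assms(1)[of "Suc n"] ge2 by linarith
  moreover have "degree (b (Suc n) * continuant a b n) \<le> Suc (Suc n)"
    using degree_mult_le[of "b (Suc n)" "continuant a b n"] assms(2)[of "Suc n"] ge2 by linarith
  ultimately show ?case by (simp add: degree_diff_le)
qed (use assms(1)[of 0] in simp_all)

text \<open>
  Coefficients that are constant to first order have a continuant that is constant to first
  order, by the product rule. This yields the missing linear term of the zeros.
\<close>

lemma continuant_has_derivative_0:
  assumes "\<And>m. ((\<lambda>h. a h m) has_field_derivative 0) (at h0)"
    "\<And>m. ((\<lambda>h. b h m) has_field_derivative 0) (at h0)"
  shows "((\<lambda>h. continuant (a h) (b h) n) has_field_derivative 0) (at h0)"
proof (induction n rule: induct_nat_012)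
  case (ge2 n)
  have "((\<lambda>h. a h (Suc n) * continuant (a h) (b h) (Suc n)) has_field_derivative 0) (at h0)"
    using DERIV_mult[OF assms(1)[of "Suc n"] ge2(2)] by simp
  moreover have "((\<lambda>h. b h (Suc n) * continuant (a h) (b h) n) has_field_derivative 0) (at h0)"
    using DERIV_mult[OF assms(2)[of "Suc n"] ge2(1)] by simp
  ultimately have "((\<lambda>h. a h (Suc n) * continuant (a h) (b h) (Suc n) -
      b h (Suc n) * continuant (a h) (b h) n) has_field_derivative 0 - 0) (at h0)"
    by (rule DERIV_diff)
  then show ?case by simp
qed (use assms(1)[of 0] in simp_all)

section \<open>Explicit sums and their recurrences\<close>

text \<open>
  For \<open>c = 0\<close> these are the unsigned Lah numbers. With a general \<open>c\<close> they are the coefficients of both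
  \<open>(c)\<^sub>n \<cdot> \<^sub>1F\<^sub>1(-n; c; \<cdot>)\<close> and \<open>(c)\<^sub>n \<cdot> \<^sub>2F\<^sub>1(-n, b; c; \<cdot>)\<close>, once the factors that do not involve \<open>n\<close> have been
  split off. Hence a single recurrence serves the Laguerre and the CRR polynomials.
\<close>

definition lah_coeff :: "'a::field_char_0 \<Rightarrow> nat \<Rightarrow> nat \<Rightarrow> 'a" where
  "lah_coeff c n k = of_nat (n choose k) * pochhammer (c + of_nat k) (n - k)"

lemma lah_coeff_eq_0: "n < k \<Longrightarrow> lah_coeff c n k = 0"
  by (simp add: lah_coeff_def)

text \<open>
  Lowering \<open>n\<close> turns into multiplication by \<open>n - k\<close>; this exchanges the weight \<open>k\<close> in a sum for
  the predecessor of that sum.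
\<close>

lemma lah_coeff_pred:
  "of_nat n * (c + of_nat n - 1) * lah_coeff c (n - 1) k = (of_nat n - of_nat k) * lah_coeff c n k"
proof (cases "k < n")
  case True
  then obtain d where d: "n = Suc (k + d)" using less_imp_Suc_add by blast
  have "of_nat (Suc (k + d)) * of_nat (k + d choose k) =
        (of_nat (Suc d * (Suc (k + d) choose k)) :: 'a)"
    using binomial_absorb_comp[of "Suc (k+d)" k] unfolding of_nat_mult[symmetric] by simp
  then have "of_nat (Suc (k + d)) * of_nat (k + d choose k) =
        (1 + of_nat d) * (of_nat (Suc (k + d) choose k) :: 'a)"
    by (simp add: algebra_simps)
  then have e: "of_nat n * of_nat (n - 1 choose k) = (1 + of_nat d) * (of_nat (n choose k) :: 'a)"
    by (simp add: d)
  define p where "p = pochhammer (c + of_nat k) d"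
  have p1: "pochhammer (c + of_nat k) (n - 1 - k) = p"
    unfolding d p_def by simp
  have p2: "pochhammer (c + of_nat k) (n - k) = p * (c + of_nat n - 1)"
    unfolding d p_def by (simp add: pochhammer_Suc Suc_diff_le add_ac)
  have nk: "of_nat n - of_nat k = (1 + of_nat d :: 'a)" by (simp add: d)
  have "of_nat n * (c + of_nat n - 1) * lah_coeff c (n - 1) k =
        (c + of_nat n - 1) * p * (of_nat n * of_nat (n - 1 choose k))"
    unfolding lah_coeff_def p1 by (simp only: mult_ac)
  also have "\<dots> = (1 + of_nat d) * (of_nat (n choose k) * (p * (c + of_nat n - 1)))"
    unfolding e by (simp only: mult_ac)
  finally show ?thesis unfolding lah_coeff_def p2 nk .
next
  case False
  then consider "k = n" | "n < k" by linarith
  then show ?thesis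
  proof cases
    case 1
    then show ?thesis by (cases n) (simp_all add: lah_coeff_eq_0)
  next
    case 2
    then show ?thesis by (simp add: lah_coeff_eq_0)
  qed
qed

lemma lah_coeff_Suc_0: "lah_coeff c (Suc n) 0 = (c + of_nat n) * lah_coeff c n 0"
  by (simp add: lah_coeff_def pochhammer_Suc)

lemma lah_coeff_Suc_Suc:
  "lah_coeff c (Suc n) (Suc k) =
     (c + of_nat n + of_nat (Suc k)) * lah_coeff c n (Suc k) + lah_coeff c n k"
proof (cases "k < n")
  case True
  then obtain d where d: "n = Suc (k + d)" using less_imp_Suc_add by blast
  have "(n - k) * (n choose k) = (Suc k) * (n choose Suc k)"
    by (simp only: binomial_absorb_comp binomial_absorption)
  then have "of_nat (Suc d) * of_nat (n choose k) = (of_nat (Suc k * (n choose Suc k)) :: 'a)"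
    unfolding d of_nat_mult[symmetric] by simp
  then have e: "(1 + of_nat d) * of_nat (n choose k) = (1 + of_nat k) * (of_nat (n choose Suc k) :: 'a)"
    by (simp add: algebra_simps)
  define p where "p = pochhammer (c + of_nat (Suc k)) d"
  have p1: "pochhammer (c + of_nat k) (n - k) = (c + of_nat k) * p"
    unfolding d p_def by (simp add: pochhammer_rec Suc_diff_le add_ac)
  have p2: "pochhammer (c + of_nat (Suc k)) (n - Suc k) = p"
    unfolding d p_def by simp
  have p3: "pochhammer (c + of_nat (Suc k)) (Suc n - Suc k) = p * (c + 1 + of_nat k + of_nat d)"
    unfolding d p_def by (simp add: pochhammer_Suc Suc_diff_le add_ac)
  have b: "of_nat (Suc n choose Suc k) = of_nat (n choose k) + (of_nat (n choose Suc k) :: 'a)"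
    by simp
  have n: "of_nat n = 1 + of_nat k + (of_nat d :: 'a)" by (simp add: d)
  define X Y where "X = (of_nat (n choose k) :: 'a)" and "Y = (of_nat (n choose Suc k) :: 'a)"
  have "(X + Y) * (p * (c + 1 + of_nat k + of_nat d)) =
     (c + (1 + of_nat k + of_nat d) + of_nat (Suc k)) * (Y * p) + X * ((c + of_nat k) * p)
       + p * ((1 + of_nat d) * X - (1 + of_nat k) * Y)"
    by (simp add: algebra_simps)
  then show ?thesis
    unfolding lah_coeff_def p1 p2 p3 b unfolding n using e unfolding X_def Y_def by simp
next
  case False
  then consider "k = n" | "n < k" by linarith
  then show ?thesis by cases (simp_all add: lah_coeff_def)
qed

definition lah_sum :: "'a::field_char_0 \<Rightarrow> (nat \<Rightarrow> 'a) \<Rightarrow> nat \<Rightarrow> 'a" where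
  "lah_sum c \<beta> n = (\<Sum>k\<le>n. lah_coeff c n k * \<beta> k)"

lemma lah_sum_weighted:
  "(\<Sum>k\<le>n. of_nat k * (lah_coeff c n k * \<beta> k)) =
     of_nat n * lah_sum c \<beta> n - of_nat n * (c + of_nat n - 1) * lah_sum c \<beta> (n - 1)"
proof -
  have "of_nat n * (c + of_nat n - 1) * lah_sum c \<beta> (n - 1) =
        of_nat n * (c + of_nat n - 1) * (\<Sum>k\<le>n. lah_coeff c (n - 1) k * \<beta> k)"
    by (cases n) (simp_all add: lah_sum_def lah_coeff_eq_0)
  also have "\<dots> = (\<Sum>k\<le>n. of_nat n * (c + of_nat n - 1) * lah_coeff c (n - 1) k * \<beta> k)"
    by (simp add: sum_distrib_left mult.assoc)
  also have "\<dots> = (\<Sum>k\<le>n. (of_nat n - of_nat k) * lah_coeff c n k * \<beta> k)"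
    by (simp only: lah_coeff_pred)
  also have "\<dots> = of_nat n * lah_sum c \<beta> n - (\<Sum>k\<le>n. of_nat k * (lah_coeff c n k * \<beta> k))"
    by (simp only: left_diff_distrib mult.assoc sum_subtractf sum_distrib_left[symmetric] lah_sum_def)
  finally show ?thesis by simp
qed

lemma lah_sum_Suc:
  "lah_sum c \<beta> (Suc n) = (c + of_nat n) * lah_sum c \<beta> n
     + (\<Sum>k\<le>n. of_nat k * (lah_coeff c n k * \<beta> k)) + (\<Sum>k\<le>n. lah_coeff c n k * \<beta> (Suc k))"
proof -
  let ?g = "\<lambda>k. (c + of_nat n + of_nat k) * lah_coeff c n k * \<beta> k"
  have "lah_sum c \<beta> (Suc n) = lah_coeff c (Suc n) 0 * \<beta> 0
          + (\<Sum>k\<le>n. lah_coeff c (Suc n) (Suc k) * \<beta> (Suc k))"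
    unfolding lah_sum_def by (rule sum.atMost_Suc_shift)
  also have "(\<Sum>k\<le>n. lah_coeff c (Suc n) (Suc k) * \<beta> (Suc k)) =
      (\<Sum>k\<le>n. ?g (Suc k) + lah_coeff c n k * \<beta> (Suc k))"
    by (simp only: lah_coeff_Suc_Suc distrib_right[of "_ * _" "lah_coeff c n _"])
  also have "lah_coeff c (Suc n) 0 * \<beta> 0 + \<dots> =
      (?g 0 + (\<Sum>k\<le>n. ?g (Suc k))) + (\<Sum>k\<le>n. lah_coeff c n k * \<beta> (Suc k))"
    by (simp add: lah_coeff_Suc_0 sum.distrib)
  also have "?g 0 + (\<Sum>k\<le>n. ?g (Suc k)) = (\<Sum>k\<le>n. ?g k)"
    unfolding sum.atMost_Suc_shift[symmetric, of ?g] by (simp add: lah_coeff_eq_0)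
  also have "\<dots> = (c + of_nat n) * lah_sum c \<beta> n + (\<Sum>k\<le>n. of_nat k * (lah_coeff c n k * \<beta> k))"
    by (simp only: distrib_right mult.assoc sum.distrib sum_distrib_left[symmetric] lah_sum_def)
  finally show ?thesis .
qed

text \<open>
  If \<open>\<beta>\<close> satisfies a first-order recurrence whose multiplier is affine in \<open>k\<close>, then the shift \<open>\<beta> (Suc k)\<close> in
  \<open>lah_sum_Suc\<close> produces only the sum itself and the sum weighted by \<open>k\<close>, and the latter is
  eliminated by \<open>lah_sum_weighted\<close>. What remains is a three-term recurrence in \<open>n\<close>.
\<close>

lemma lah_sum_eq_continuant:
  assumes "\<beta> 0 = 1" and \<beta>: "\<And>k. \<beta> (Suc k) = (p + q * of_nat k) * \<beta> k"
  shows "lah_sum c \<beta> n =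
    continuant (\<lambda>m. (1 + q) * of_nat m + (c + of_nat m + p))
               (\<lambda>m. (1 + q) * (of_nat m * (c + of_nat m - 1))) n"
proof (rule sym, rule continuant_eqI)
  have rec: "lah_sum c \<beta> (Suc m) = ((1 + q) * of_nat m + (c + of_nat m + p)) * lah_sum c \<beta> m
      - (1 + q) * (of_nat m * (c + of_nat m - 1)) * lah_sum c \<beta> (m - 1)" for m
  proof -
    have "(\<Sum>k\<le>m. lah_coeff c m k * \<beta> (Suc k)) =
          (\<Sum>k\<le>m. p * (lah_coeff c m k * \<beta> k) + q * (of_nat k * (lah_coeff c m k * \<beta> k)))"
      by (intro sum.cong) (simp_all add: \<beta> algebra_simps)
    also have "\<dots> = p * lah_sum c \<beta> m + q * (\<Sum>k\<le>m. of_nat k * (lah_coeff c m k * \<beta> k))"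
      by (simp only: sum.distrib sum_distrib_left[symmetric] lah_sum_def)
    finally have *: "(\<Sum>k\<le>m. lah_coeff c m k * \<beta> (Suc k)) =
        p * lah_sum c \<beta> m + q * (\<Sum>k\<le>m. of_nat k * (lah_coeff c m k * \<beta> k))" .
    show ?thesis unfolding lah_sum_Suc * lah_sum_weighted by (simp add: algebra_simps)
  qed
  show l0: "lah_sum c \<beta> 0 = 1" by (simp add: lah_sum_def lah_coeff_def assms)
  show "lah_sum c \<beta> (Suc 0) = (1 + q) * of_nat 0 + (c + of_nat 0 + p)"
    using rec[of 0] by (simp add: l0)
  show "lah_sum c \<beta> (Suc (Suc m)) =
       ((1 + q) * of_nat (Suc m) + (c + of_nat (Suc m) + p)) * lah_sum c \<beta> (Suc m)
       - (1 + q) * (of_nat (Suc m) * (c + of_nat (Suc m) - 1)) * lah_sum c \<beta> m" for m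
    using rec[of "Suc m"] by simp
qed

lemma hermite_eq_continuant:
  "hermite n = continuant (\<lambda>m. [:0, 2:]) (\<lambda>m. [:2 * of_nat m:]) n"
  by (induction n rule: hermite.induct) (auto simp: algebra_simps)

lemma laguerre_eq_lah_sum:
  "fact n * poly (laguerre \<alpha> n) x = lah_sum (\<alpha> + 1) (\<lambda>k. (- x) ^ k) n"
proof -
  have "fact n * poly (laguerre \<alpha> n) x =
     (\<Sum>k\<le>n. fact n * ((-1) ^ k * ((of_nat n + \<alpha>) gchoose (n - k)) / fact k) * x ^ k)"
    by (simp add: laguerre_def poly_sum poly_monom sum_distrib_left mult.assoc)
  also have "\<dots> = lah_sum (\<alpha> + 1) (\<lambda>k. (- x) ^ k) n"
    unfolding lah_sum_def
  proof (rule sum.cong[OF refl])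
    fix k assume "k \<in> {..n}"
    then have k: "k \<le> n" by simp
    then have "(of_nat n + \<alpha>) gchoose (n - k) = pochhammer (\<alpha> + 1 + of_nat k) (n - k) / fact (n - k)"
      by (simp add: gbinomial_pochhammer' of_nat_diff add_ac)
    moreover have "fact n = fact k * fact (n - k) * (of_nat (n choose k) :: real)"
      using k by (simp add: binomial_fact)
    ultimately show "fact n * ((-1) ^ k * ((of_nat n + \<alpha>) gchoose (n - k)) / fact k) * x ^ k =
        lah_coeff (\<alpha> + 1) n k * (- x) ^ k"
      by (simp add: lah_coeff_def power_minus[of x])
  qed
  finally show ?thesis .
qed

text \<open>
  The powers of \<open>-x\<close> are the case of a constant multiplier.
\<close>

lemma laguerre_eq_continuant:
  "fact n * poly (laguerre \<alpha> n) x =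
     continuant (\<lambda>m. 2 * of_nat m + 1 + \<alpha> - x) (\<lambda>m. of_nat m * (of_nat m + \<alpha>)) n"
  unfolding laguerre_eq_lah_sum
  by (subst lah_sum_eq_continuant[where p = "-x" and q = 0]) (simp_all add: algebra_simps)

text \<open>
  For \<open>x \<le> 0\<close> all terms of the explicit sum are nonnegative, so the zeros lie on the positive axis.
\<close>

lemma laguerre_pos:
  assumes "\<alpha> > -1" "x \<le> 0"
  shows "poly (laguerre \<alpha> n) x > 0"
proof -
  have "lah_sum (\<alpha> + 1) (\<lambda>k. (- x) ^ k) n > 0"
    unfolding lah_sum_def
  proof (rule sum_pos2[of _ 0])
    show "0 < lah_coeff (\<alpha> + 1) n 0 * (- x) ^ 0"
      using assms by (simp add: lah_coeff_def pochhammer_pos)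
    show "0 \<le> lah_coeff (\<alpha> + 1) n k * (- x) ^ k" for k
      using assms by (simp add: lah_coeff_def pochhammer_nonneg)
  qed auto
  then have "fact n * poly (laguerre \<alpha> n) x > 0" by (simp only: laguerre_eq_lah_sum)
  then show ?thesis by (simp add: zero_less_mult_iff)
qed

text \<open>
  With \<open>w = x - \<i>\<close>, the hypergeometric sum is the Lah sum of \<open>\<beta> k = (b)\<^sub>k (2\<i>/w)\<^sup>k\<close>, whose
  multiplier \<open>(b + k) \<cdot> 2\<i>/w\<close> is affine in \<open>k\<close>. The factor \<open>w\<^sup>n\<close> is absorbed by \<open>continuant_scale\<close>, and the
  resulting coefficients are real, since \<open>w(w + 2\<i>) = x\<^sup>2 + 1\<close>.
\<close>

lemma CRR_eq_continuant:
  assumes "lam > 0"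
  shows "CRR (Complex lam \<eta>) n x = of_real
    (continuant (\<lambda>m. 2 * (of_nat m + lam) * x - 2 * \<eta>)
                (\<lambda>m. of_nat m * (of_nat m - 1 + 2 * lam) * (x\<^sup>2 + 1)) n
       / (2 ^ n * pochhammer lam n))"
proof -
  define w where "w = complex_of_real x - \<i>"
  define b where "b = Complex lam \<eta>"
  define c where "c = complex_of_real (2 * lam)"
  have b: "b = of_real lam + \<i> * of_real \<eta>" by (simp add: b_def complex_eq_iff)
  have bc: "b + cnj b = c" by (simp add: b_def c_def complex_eq_iff)
  have w: "w \<noteq> 0" by (simp add: w_def complex_eq_iff)
  have nz: "pochhammer c k \<noteq> 0" for k
    using assms pochhammer_pos[of "2 * lam" k] unfolding c_def pochhammer_of_real by simp
  let ?t = "\<lambda>k. pochhammer (- of_nat n) k * pochhammer b k / (pochhammer c k * fact k)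
                   * (-2 * \<i> / w) ^ k"
  define \<beta> where "\<beta> = (\<lambda>k. pochhammer b k * (2 * \<i> / w) ^ k)"
  have "hyp2F1 (- of_nat n) b c (- 2 * \<i> / w) = (\<Sum>k. ?t k)"
    by (simp add: hyp2F1_def eval_fps_def)
  also have "\<dots> = (\<Sum>k\<le>n. ?t k)"
    by (rule suminf_finite) (auto simp: pochhammer_of_nat_eq_0_iff)
  finally have "pochhammer c n * hyp2F1 (- of_nat n) b c (- 2 * \<i> / w) = (\<Sum>k\<le>n. pochhammer c n * ?t k)"
    by (simp only: sum_distrib_left)
  also have "\<dots> = lah_sum c \<beta> n"
    unfolding lah_sum_def
  proof (rule sum.cong[OF refl])
    fix k assume "k \<in> {..n}"
    then have k: "k \<le> n" by simp
    have "pochhammer (- of_nat n) k = (-1) ^ k * (fact k * of_nat (n choose k) :: complex)"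
      using gbinomial_pochhammer[of "of_nat n :: complex" k]
      by (simp add: binomial_gbinomial)
    moreover have "pochhammer c n = pochhammer c k * pochhammer (c + of_nat k) (n - k)"
      using pochhammer_product[OF k] .
    moreover have "(-2 * \<i> / w) ^ k = (-1) ^ k * (2 * \<i> / w) ^ k"
      by (simp add: power_mult_distrib[symmetric])
    moreover have "(A * R) * (s * (F * N) * B / (A * F) * (s * Z)) = N * R * (B * Z)"
      if "A \<noteq> 0" "F \<noteq> 0" "s * s = 1" for A R s F N B Z :: complex
    proof -
      have "(A * R) * (s * (F * N) * B / (A * F) * (s * Z)) = (s * s) * (N * R * (B * Z))"
        using that(1,2) by simp
      then show ?thesis using that(3) by simp
    qed
    ultimately show "pochhammer c n * ?t k = lah_coeff c n k * \<beta> k"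
      using nz[of k] by (simp only: lah_coeff_def \<beta>_def) (simp add: power_mult_distrib[symmetric])
  qed
  also have "\<dots> = continuant (\<lambda>m. (1 + 2 * \<i> / w) * of_nat m + (c + of_nat m + b * (2 * \<i> / w)))
               (\<lambda>m. (1 + 2 * \<i> / w) * (of_nat m * (c + of_nat m - 1))) n"
  proof (rule lah_sum_eq_continuant)
    have "pochhammer b (Suc k) * v ^ Suc k = (b * v + v * of_nat k) * (pochhammer b k * v ^ k)" for k v
      by (simp add: pochhammer_Suc algebra_simps)
    then show "\<beta> (Suc k) = (b * (2 * \<i> / w) + 2 * \<i> / w * of_nat k) * \<beta> k" for k
      unfolding \<beta>_def .
  qed (simp add: \<beta>_def)
  finally have "w ^ n * (pochhammer c n * hyp2F1 (- of_nat n) b c (- 2 * \<i> / w)) =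
     continuant (\<lambda>m. w * ((1 + 2 * \<i> / w) * of_nat m + (c + of_nat m + b * (2 * \<i> / w))))
               (\<lambda>m. w\<^sup>2 * ((1 + 2 * \<i> / w) * (of_nat m * (c + of_nat m - 1)))) n"
    by (simp only: continuant_scale)
  also have "(\<lambda>m. w * ((1 + 2 * \<i> / w) * of_nat m + (c + of_nat m + b * (2 * \<i> / w)))) =
     (\<lambda>m. of_real (2 * (of_nat m + lam) * x - 2 * \<eta>))"
  proof
    fix m
    have "w * ((1 + 2 * \<i> / w) * of_nat m + (c + of_nat m + b * (2 * \<i> / w))) =
          (w + 2 * \<i>) * of_nat m + (w * (c + of_nat m) + b * (2 * \<i>))"
      using w by (simp add: field_simps)
    also have "\<dots> = of_real (2 * (of_nat m + lam) * x - 2 * \<eta>)"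
      by (simp add: w_def b c_def complex_eq_iff algebra_simps)
    finally show "w * ((1 + 2 * \<i> / w) * of_nat m + (c + of_nat m + b * (2 * \<i> / w))) =
       of_real (2 * (of_nat m + lam) * x - 2 * \<eta>)" .
  qed
  also have "(\<lambda>m. w\<^sup>2 * ((1 + 2 * \<i> / w) * (of_nat m * (c + of_nat m - 1)))) =
     (\<lambda>m. of_real (of_nat m * (of_nat m - 1 + 2 * lam) * (x\<^sup>2 + 1)))"
  proof
    fix m
    have "w\<^sup>2 * ((1 + 2 * \<i> / w) * (of_nat m * (c + of_nat m - 1))) =
          (w * (w + 2 * \<i>)) * (of_nat m * (c + of_nat m - 1))"
      using w by (simp add: field_simps power2_eq_square)
    also have "w * (w + 2 * \<i>) = of_real (x\<^sup>2 + 1)"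
      by (simp add: w_def complex_eq_iff algebra_simps power2_eq_square)
    finally show "w\<^sup>2 * ((1 + 2 * \<i> / w) * (of_nat m * (c + of_nat m - 1))) =
       of_real (of_nat m * (of_nat m - 1 + 2 * lam) * (x\<^sup>2 + 1))"
      by (simp add: c_def algebra_simps)
  qed
  finally have "w ^ n * (pochhammer c n * hyp2F1 (- of_nat n) b c (- 2 * \<i> / w)) =
     of_real (continuant (\<lambda>m. 2 * (of_nat m + lam) * x - 2 * \<eta>)
                (\<lambda>m. of_nat m * (of_nat m - 1 + 2 * lam) * (x\<^sup>2 + 1)) n)"
    by (simp only: continuant_of_real)
  then show ?thesis
    unfolding CRR_def b_def[symmetric] bc w_def[symmetric]
    by (simp add: b_def c_def pochhammer_of_real[symmetric] field_simps)
qed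

section \<open>Interlacing real zeros\<close>

lemma strict_mono_below:
  fixes t :: "nat \<Rightarrow> 'a::order"
  assumes "\<And>i. i < m \<Longrightarrow> t i < t (Suc i)" "i < j" "j \<le> m"
  shows "t i < t j"
  using assms(2,3)
proof (induction j)
  case (Suc j)
  then show ?case using assms(1)[of j] by (cases "i = j") (auto intro: less_trans)
qed simp

text \<open>
  Each root to the right of \<open>x\<close> contributes one change of sign.
\<close>

lemma prod_linear_factors_sign:
  fixes x :: real
  assumes "j \<le> m" "\<And>i. i < j \<Longrightarrow> z i < x" "\<And>i. j \<le> i \<Longrightarrow> i < m \<Longrightarrow> x < z i"
  shows "0 < (-1) ^ (m - j) * (\<Prod>i<m. x - z i)"
  using assms
proof (induction m rule: dec_induct)
  case base
  then show ?case by (auto intro!: prod_pos)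
next
  case (step m)
  then have "0 < (-1) ^ (m - j) * (\<Prod>i<m. x - z i)" "x < z m" by auto
  then have "0 < ((-1) ^ (m - j) * (\<Prod>i<m. x - z i)) * (z m - x)" by simp
  then show ?case using step.hyps by (simp add: Suc_diff_le algebra_simps)
qed

lemma poly_eq_prod_roots:
  fixes p :: "'a::idom poly"
  assumes "degree p = N" "inj_on y {..<N}" "\<And>i. i < N \<Longrightarrow> poly p (y i) = 0"
  shows "p = smult (lead_coeff p) (\<Prod>i<N. [:- y i, 1:])"
proof (rule ccontr)
  let ?q = "\<Prod>i<N. [:- y i, 1:]"
  let ?d = "p - smult (lead_coeff p) ?q"
  assume "p \<noteq> smult (lead_coeff p) ?q"
  \<comment> \<open>The difference of both sides has degree below \<open>N\<close>, since the leading terms cancel, but \<open>N\<close> zeros.\<close>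
  then have d0: "?d \<noteq> 0" by simp
  have dq: "degree ?q = N"
    by (subst degree_prod_sum_eq) auto
  have "lead_coeff ?q = 1" by (simp add: lead_coeff_prod)
  then have "coeff ?d N = 0" using assms(1) dq by simp
  moreover have "degree ?d \<le> N"
    using assms(1) dq by (intro degree_diff_le) auto
  ultimately have "degree ?d < N"
    using d0 eq_zero_or_degree_less by blast
  moreover have "y ` {..<N} \<subseteq> {x. poly ?d x = 0}"
    using assms(3) by (auto simp: poly_prod intro!: bexI)
  then have "N \<le> card {x. poly ?d x = 0}"
    using card_mono[OF poly_roots_finite[OF d0], of "y ` {..<N}"] card_image[OF assms(2)]
    by simp
  then have "N \<le> degree ?d"
    using card_poly_roots_bound[OF d0] by linarith
  ultimately show False by simp
qed

lemma poly_sign_at_minus_infinity: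
  fixes p :: "real poly"
  assumes "lead_coeff p > 0"
  shows "\<exists>x<B. 0 < (-1) ^ degree p * poly p x"
proof -
  define q where "q = smult ((-1) ^ degree p) (pcompose p [:0, -1:])"
  have "lead_coeff q = lead_coeff p"
    by (simp add: q_def lead_coeff_comp power_mult_distrib[symmetric])
  then obtain n where "\<And>x. x \<ge> n \<Longrightarrow> 0 < poly q x"
    using poly_pinfty_gt_lc[of q] assms by force
  from this[of "max n (1 - B)"] show ?thesis
    by (intro exI[of _ "- max n (1 - B)"]) (auto simp: q_def poly_pcompose)
qed

text \<open>
  The interlacing is stated for the factorizations themselves, because the sign of one
  polynomial at the zeros of the other is read off from the linear factors.
\<close>

definition interlacing_polys :: "nat \<Rightarrow> real poly \<Rightarrow> real poly \<Rightarrow> bool" where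
  "interlacing_polys m p q \<longleftrightarrow> (\<exists>c d z w. c > 0 \<and> d > 0 \<and>
     p = smult c (\<Prod>i<m. [:- z i, 1:]) \<and> q = smult d (\<Prod>i<Suc m. [:- w i, 1:]) \<and>
     (\<forall>i<m. w i < z i \<and> z i < w (Suc i)))"

text \<open>
  At the zeros of \<open>q\<close> the new polynomial equals \<open>-k p\<close>, whose signs alternate there by interlacing. The
  signs at both infinities continue this alternation, so the intermediate value theorem gives a
  zero in each of the \<open>m + 2\<close> gaps, as many as the degree allows.
\<close>

lemma interlacing_polys_step:
  assumes "interlacing_polys m p q" and v: "v > 0" and k: "k > 0"
  shows "interlacing_polys (Suc m) q ([:u, v:] * q - smult k p)"
proof -
  from assms(1) obtain c d z w where cd: "c > 0" "d > 0"
    and p: "p = smult c (\<Prod>i<m. [:- z i, 1:])" and q: "q = smult d (\<Prod>i<Suc m. [:- w i, 1:])"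
    and wz: "\<And>i. i < m \<Longrightarrow> w i < z i" "\<And>i. i < m \<Longrightarrow> z i < w (Suc i)"
    unfolding interlacing_polys_def by blast
  have w_mono: "w i < w j" if "i < j" "j \<le> m" for i j
    using that strict_mono_below[of m w i j] wz by (meson less_trans)
  define r where "r = [:u, v:] * q - smult k p"
  have q0: "q \<noteq> 0" using cd by (simp add: q del: prod.lessThan_Suc)
  have degq: "degree q = Suc m"
    unfolding q using cd by (simp only: degree_smult_eq) (subst degree_prod_sum_eq; simp)
  have degp: "degree p = m"
    unfolding p using cd by (simp only: degree_smult_eq) (subst degree_prod_sum_eq; simp)
  have "lead_coeff q = d"
    unfolding q by (simp add: lead_coeff_prod lead_coeff_mult del: prod.lessThan_Suc)
  moreover have deg1: "degree ([:u, v:] * q) = Suc (Suc m)"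
    using v q0 degq by (subst degree_mult_eq) auto
  moreover have degr: "degree r = Suc (Suc m)"
    unfolding r_def diff_conv_add_uminus using deg1 degp k
    by (subst degree_add_eq_left) auto
  ultimately have leadr: "lead_coeff r = v * d"
  proof -
    assume *: "lead_coeff q = d" "degree ([:u, v:] * q) = Suc (Suc m)" "degree r = Suc (Suc m)"
    have "coeff (smult k p) (Suc (Suc m)) = 0"
      by (rule coeff_eq_0) (use degp in \<open>auto simp: le_less_trans[OF degree_smult_le]\<close>)
    moreover have "coeff ([:u, v:] * q) (Suc (Suc m)) = v * d"
      using * v lead_coeff_mult[of "[:u, v:]" q] by simp
    ultimately show ?thesis using * by (simp add: r_def)
  qed
  have rw: "0 < (-1) ^ (Suc m - i) * poly r (w i)" if i: "i \<le> m" for i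
  proof -
    have "0 < (-1) ^ (m - i) * (\<Prod>j<m. w i - z j)"
    proof (rule prod_linear_factors_sign[OF i])
      show "z j < w i" if "j < i" for j
        using wz(2)[of j] w_mono[of "Suc j" i] that i by (cases "Suc j = i") auto
      show "w i < z j" if "i \<le> j" "j < m" for j
        using wz(1)[of j] w_mono[of i j] that by (cases "i = j") auto
    qed
    then have "0 < (k * c) * ((-1) ^ (m - i) * (\<Prod>j<m. w i - z j))" using cd k by simp
    moreover have "poly q (w i) = 0" using i by (auto simp: q poly_prod simp del: prod.lessThan_Suc)
    ultimately show ?thesis using i by (simp add: r_def p poly_prod Suc_diff_le algebra_simps)
  qed
  obtain lo where lo: "lo < w 0" "0 < (-1) ^ Suc (Suc m) * poly r lo"
    using poly_sign_at_minus_infinity[of r "w 0"] leadr degr v cd by auto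
  obtain hi where hi: "w m < hi" "0 < poly r hi"
  proof -
    have "lead_coeff r > 0" using leadr v cd by simp
    then obtain n where "\<And>x. x \<ge> n \<Longrightarrow> 0 < poly r x"
      using poly_pinfty_gt_lc[of r] by force
    from this[of "max n (w m + 1)"] show ?thesis by (intro that[of "max n (w m + 1)"]) auto
  qed
  \<comment> \<open>The points \<open>t 0 < \<dots> < t (m + 2)\<close> are the zeros of \<open>q\<close>, framed by two points far out
  where the leading term decides the sign.\<close>
  define t where "t = (\<lambda>i. if i = 0 then lo else if i = Suc (Suc m) then hi else w (i - 1))"
  have t_mono: "t i < t (Suc i)" if "i < Suc (Suc m)" for i
    using that lo hi w_mono[of "i - 1" i] by (cases "i = 0"; cases "i = Suc m") (auto simp: t_def)
  have t_sign: "0 < (-1) ^ (Suc (Suc m) - i) * poly r (t i)" if "i \<le> Suc (Suc m)" for i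
    using that lo hi rw[of "i - 1"]
    by (cases i) (auto simp: t_def le_Suc_eq)
  have "\<exists>x. t i < x \<and> x < t (Suc i) \<and> poly r x = 0" if i: "i < Suc (Suc m)" for i
  proof -
    have e: "Suc (Suc m) - i = Suc (Suc (Suc m) - Suc i)" using i by simp
    define s :: real where "s = (-1) ^ (Suc (Suc m) - Suc i)"
    have "0 < - s * poly r (t i)" "0 < s * poly r (t (Suc i))"
      using t_sign[of i] t_sign[of "Suc i"] i unfolding e s_def by auto
    moreover have "s = 1 \<or> s = -1"
      unfolding s_def by (cases "even (Suc (Suc m) - Suc i)") simp_all
    ultimately have "poly r (t i) * poly r (t (Suc i)) < 0"
      by (auto simp: mult_less_0_iff)
    then show ?thesis using poly_IVT[OF t_mono[OF i]] by blast
  qed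
  then obtain y where y: "\<And>i. i < Suc (Suc m) \<Longrightarrow> t i < y i"
      "\<And>i. i < Suc (Suc m) \<Longrightarrow> y i < t (Suc i)" "\<And>i. i < Suc (Suc m) \<Longrightarrow> poly r (y i) = 0"
    by metis
  have yw: "y i < w i \<and> w i < y (Suc i)" if "i < Suc m" for i
    using y(2)[of i] y(1)[of "Suc i"] that by (simp add: t_def)
  have "y i < y j" if "i < j" "j < Suc (Suc m)" for i j
    using that strict_mono_below[of "Suc m" y i j] yw by (meson less_Suc_eq_le less_trans)
  then have "inj_on y {..<Suc (Suc m)}"
    by (intro linorder_inj_onI) (auto simp: less_imp_neq)
  from poly_eq_prod_roots[OF degr this y(3)]
  have "r = smult (v * d) (\<Prod>i<Suc (Suc m). [:- y i, 1:])" using leadr by simp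
  then show ?thesis
    unfolding interlacing_polys_def r_def[symmetric]
    using cd v q yw by (intro exI[of _ d] exI[of _ "v * d"] exI[of _ w] exI[of _ y]) auto
qed

lemma interlacing_continuants:
  fixes u v k :: "nat \<Rightarrow> real"
  assumes "\<And>m. v m > 0" "\<And>m. k (Suc m) > 0"
  shows "interlacing_polys m (continuant (\<lambda>m. [:u m, v m:]) (\<lambda>m. [:k m:]) m)
           (continuant (\<lambda>m. [:u m, v m:]) (\<lambda>m. [:k m:]) (Suc m))"
proof (induction m)
  case 0
  have "[:u 0, v 0:] = smult (v 0) [:- (- u 0 / v 0), 1:]"
    using assms(1)[of 0] by simp
  then show ?case
    unfolding interlacing_polys_def using assms(1)[of 0]
    by (intro exI[of _ 1] exI[of _ "v 0"] exI[of _ "\<lambda>_. 0"] exI[of _ "\<lambda>_. - u 0 / v 0"]) simp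
next
  case (Suc m)
  from interlacing_polys_step[OF this assms(1)[of "Suc m"] assms(2)[of m], of "u (Suc m)"]
  show ?case by simp
qed

lemma card_roots_continuant:
  fixes u v k :: "nat \<Rightarrow> real"
  assumes "\<And>m. v m > 0" "\<And>m. k (Suc m) > 0"
  shows "card {x. poly (continuant (\<lambda>m. [:u m, v m:]) (\<lambda>m. [:k m:]) n) x = 0} = n"
proof -
  obtain c z w where c: "c > 0"
    and p: "continuant (\<lambda>m. [:u m, v m:]) (\<lambda>m. [:k m:]) n = smult c (\<Prod>i<n. [:- z i, 1:])"
    and zw: "\<forall>i<n. w i < z i \<and> z i < w (Suc i)"
    using interlacing_continuants[where u = u and v = v and k = k and m = n] assms
    unfolding interlacing_polys_def by blast
  have "z i < z (Suc i)" if "i < n - 1" for i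
    using zw that by (metis Suc_lessD less_diff_conv less_trans Suc_eq_plus1)
  then have "z i < z j" if "i < j" "j < n" for i j
    using strict_mono_below[of "n - 1" z i j] that by simp
  then have "inj_on z {..<n}"
    by (intro linorder_inj_onI) (auto simp: less_imp_neq)
  moreover have "{x. poly (continuant (\<lambda>m. [:u m, v m:]) (\<lambda>m. [:k m:]) n) x = 0} = z ` {..<n}"
    using c by (auto simp: p poly_prod)
  ultimately show ?thesis by (simp add: card_image)
qed

lemma card_zeros_hermite: "card {x. poly (hermite n) x = 0} = n"
  unfolding hermite_eq_continuant by (rule card_roots_continuant) simp_all

text \<open>
  The recurrence of the Laguerre polynomials has negative leading coefficients; scaling by \<open>-1\<close>
  makes them positive.
\<close>

lemma card_zeros_laguerre:
  assumes "\<alpha> > -1"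
  shows "card {x. poly (laguerre \<alpha> n) x = 0} = n"
proof -
  define p where "p = continuant (\<lambda>m. [:- (2 * of_nat m + 1 + \<alpha>), 1:]) (\<lambda>m. [:of_nat m * (of_nat m + \<alpha>):]) n"
  have "poly p x = (-1) ^ n * (fact n * poly (laguerre \<alpha> n) x)" for x
    unfolding p_def poly_continuant laguerre_eq_continuant continuant_scale[symmetric]
    by (simp add: algebra_simps)
  then have "{x. poly (laguerre \<alpha> n) x = 0} = {x. poly p x = 0}" by simp
  moreover have "card {x. poly p x = 0} = n"
    unfolding p_def using assms by (intro card_roots_continuant) auto
  ultimately show ?thesis by simp
qed

section \<open>Holomorphic implicit functions of two variables\<close>

text \<open>
  Holomorphy in both variables is expressed through the real derivative on pairs, which is the
  form in which the inverse function theorem takes it; the two functions besides \<open>F\<close> are its complex partial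
  derivatives.
\<close>

definition holo_partials ::
    "(complex \<times> complex \<Rightarrow> complex) \<Rightarrow> (complex \<times> complex \<Rightarrow> complex) \<Rightarrow>
     (complex \<times> complex \<Rightarrow> complex) \<Rightarrow> bool" where
  "holo_partials F A B \<longleftrightarrow> continuous_on UNIV A \<and> continuous_on UNIV B \<and>
     (\<forall>z. (F has_derivative (\<lambda>v. A z * fst v + B z * snd v)) (at z))"

lemma holo_partials_D:
  assumes "holo_partials F A B"
  shows "continuous_on UNIV A" "continuous_on UNIV B"
    "(F has_derivative (\<lambda>v. A z * fst v + B z * snd v)) (at z)"
  using assms unfolding holo_partials_def by blast+

lemma holo_partials_fst: "holo_partials fst (\<lambda>_. 1) (\<lambda>_. 0)"
  and holo_partials_snd: "holo_partials snd (\<lambda>_. 0) (\<lambda>_. 1)"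
  and holo_partials_const: "holo_partials (\<lambda>_. c) (\<lambda>_. 0) (\<lambda>_. 0)"
  unfolding holo_partials_def by (auto intro!: derivative_eq_intros)

lemma holo_partials_add:
  assumes "holo_partials F A B" "holo_partials G C D"
  shows "holo_partials (\<lambda>z. F z + G z) (\<lambda>z. A z + C z) (\<lambda>z. B z + D z)"
proof -
  have "((\<lambda>z. F z + G z) has_derivative (\<lambda>v. (A z + C z) * fst v + (B z + D z) * snd v)) (at z)" for z
    by (rule has_derivative_eq_rhs, rule has_derivative_add[OF assms[THEN holo_partials_D(3)]])
       (auto simp: algebra_simps)
  then show ?thesis
    using assms unfolding holo_partials_def by (auto intro!: continuous_intros)
qed

lemma holo_partials_mult:
  assumes "holo_partials F A B" "holo_partials G C D"
  shows "holo_partials (\<lambda>z. F z * G z) (\<lambda>z. A z * G z + F z * C z) (\<lambda>z. B z * G z + F z * D z)"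
proof -
  have "((\<lambda>z. F z * G z) has_derivative
      (\<lambda>v. (A z * G z + F z * C z) * fst v + (B z * G z + F z * D z) * snd v)) (at z)" for z
    by (rule has_derivative_eq_rhs, rule has_derivative_mult[OF assms[THEN holo_partials_D(3)]])
       (auto simp: algebra_simps)
  moreover have "continuous_on UNIV F" "continuous_on UNIV G"
    using assms[THEN holo_partials_D(3)]
    by (auto intro!: continuous_at_imp_continuous_on has_derivative_continuous)
  ultimately show ?thesis
    using assms unfolding holo_partials_def by (auto intro!: continuous_intros)
qed

definition jointly_holomorphic :: "(complex \<times> complex \<Rightarrow> complex) \<Rightarrow> bool" where
  "jointly_holomorphic F \<longleftrightarrow> (\<exists>A B. holo_partials F A B)"

lemma jointly_holomorphic_const: "jointly_holomorphic (\<lambda>_. c)"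
  and jointly_holomorphic_fst: "jointly_holomorphic (\<lambda>z. fst z)"
  and jointly_holomorphic_snd: "jointly_holomorphic (\<lambda>z. snd z)"
  unfolding jointly_holomorphic_def
  using holo_partials_fst holo_partials_snd holo_partials_const by blast+

lemma jointly_holomorphic_add:
  "jointly_holomorphic F \<Longrightarrow> jointly_holomorphic G \<Longrightarrow> jointly_holomorphic (\<lambda>z. F z + G z)"
  unfolding jointly_holomorphic_def using holo_partials_add by blast

lemma jointly_holomorphic_mult:
  "jointly_holomorphic F \<Longrightarrow> jointly_holomorphic G \<Longrightarrow> jointly_holomorphic (\<lambda>z. F z * G z)"
  unfolding jointly_holomorphic_def using holo_partials_mult by blast

lemma jointly_holomorphic_diff:
  assumes "jointly_holomorphic F" "jointly_holomorphic G"
  shows "jointly_holomorphic (\<lambda>z. F z - G z)"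
  using jointly_holomorphic_add[OF assms(1)
      jointly_holomorphic_mult[OF jointly_holomorphic_const[of "-1"] assms(2)]] by simp

lemma jointly_holomorphic_power:
  "jointly_holomorphic F \<Longrightarrow> jointly_holomorphic (\<lambda>z. F z ^ k)"
  by (induction k) (auto intro: jointly_holomorphic_const jointly_holomorphic_mult)

lemmas jointly_holomorphic_intros =
  jointly_holomorphic_const jointly_holomorphic_fst jointly_holomorphic_snd
  jointly_holomorphic_add jointly_holomorphic_mult jointly_holomorphic_diff
  jointly_holomorphic_power

lemma jointly_holomorphic_continuant:
  assumes "\<And>m. jointly_holomorphic (\<lambda>z. a z m)" "\<And>m. jointly_holomorphic (\<lambda>z. b z m)"
  shows "jointly_holomorphic (\<lambda>z. continuant (a z) (b z) n)"
proof (induction n rule: induct_nat_012)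
  case (ge2 n)
  then show ?case using assms by (auto intro!: jointly_holomorphic_intros)
qed (use assms in \<open>auto intro!: jointly_holomorphic_intros\<close>)

text \<open>
  The map \<open>(h, y) \<mapsto> (h, F(h, y))\<close> has an invertible derivative at \<open>(0, y0)\<close>, so the real inverse function
  theorem applies to it. The inverse maps \<open>(h, 0)\<close> to \<open>(h, \<phi> h)\<close>, and its derivative is
  complex linear as the inverse of a complex linear map; hence \<open>\<phi>\<close> is holomorphic. Injectivity of the
  map gives the uniqueness clause.
\<close>

lemma holomorphic_implicit_function:
  assumes F: "holo_partials F A B" and zero: "F (0, y0) = 0" and B0: "B (0, y0) \<noteq> 0"
  obtains r e \<phi> where "r > 0" "e > 0" "\<phi> holomorphic_on ball 0 r" "\<phi> 0 = y0"
    "deriv \<phi> 0 = - A (0, y0) / B (0, y0)"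
    "\<And>h. h \<in> ball 0 r \<Longrightarrow> F (h, \<phi> h) = 0" "\<And>h. h \<in> ball 0 r \<Longrightarrow> \<phi> h \<in> ball y0 e"
    "\<And>h y. h \<in> ball 0 r \<Longrightarrow> y \<in> ball y0 e \<Longrightarrow> F (h, y) = 0 \<Longrightarrow> y = \<phi> h"
proof -
  define G where "G = (\<lambda>z. (fst z, F z))"
  define L where "L = (\<lambda>z v. (fst v, A z * fst v + B z * snd v))"
  define z0 where "z0 = (0::complex, y0)"
  have derG: "(G has_derivative L z) (at z)" for z
    unfolding G_def L_def
    by (intro has_derivative_Pair holo_partials_D(3)[OF F] has_derivative_fst has_derivative_ident)
  have blL: "bounded_linear (L z)" for z
    using derG has_derivative_bounded_linear by blast
  define G' where "G' = (\<lambda>z. Blinfun (L z))"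
  have G': "blinfun_apply (G' z) = L z" for z
    unfolding G'_def using blL by (rule bounded_linear_Blinfun_apply)
  have contG': "continuous_on UNIV G'"
  proof (rule continuous_on_blinfun_componentwise)
    fix i :: "complex \<times> complex"
    show "continuous_on UNIV (\<lambda>z. blinfun_apply (G' z) i)"
      unfolding G' L_def using holo_partials_D(1,2)[OF F] by (intro continuous_intros)
  qed
  define M where "M = Blinfun (\<lambda>v. (fst v, (snd v - A z0 * fst v) / B z0))"
  have blM: "bounded_linear (\<lambda>v. (fst v, (snd v - A z0 * fst v) / B z0))"
    by (intro bounded_linear_Pair bounded_linear_fst bounded_linear_divide[THEN bounded_linear_compose]
          bounded_linear_sub bounded_linear_snd bounded_linear_const_mult)
  have M: "blinfun_apply M = (\<lambda>v. (fst v, (snd v - A z0 * fst v) / B z0))"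
    unfolding M_def by (rule bounded_linear_Blinfun_apply[OF blM])
  have MG: "M o\<^sub>L G' z0 = id_blinfun"
  proof (rule blinfun_eqI)
    fix v
    show "blinfun_apply (M o\<^sub>L G' z0) v = blinfun_apply id_blinfun v"
      using B0[folded z0_def] by (simp add: M G' L_def)
  qed
  have derG': "(G has_derivative blinfun_apply (G' z)) (at z)" for z
    unfolding G' by (rule derG)
  obtain U V g g' where U: "open U" "z0 \<in> U" and V: "open V" "G z0 \<in> V"
    and hom: "homeomorphism U V G g"
    and derg: "\<And>y. y \<in> V \<Longrightarrow> (g has_derivative (g' y)) (at y)"
    and g': "\<And>y. y \<in> V \<Longrightarrow> g' y = inv (blinfun_apply (G' (g y)))"
    and bij: "\<And>y. y \<in> V \<Longrightarrow> bij (blinfun_apply (G' (g y)))"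
    by (rule inverse_function_theorem[OF open_UNIV derG' contG' UNIV_I MG]) blast
  have Gz0: "G z0 = (0, 0)" using zero by (simp add: G_def z0_def)
  have Gg: "G (g y) = y" "g y \<in> U" if "y \<in> V" for y
    using hom that by (auto simp: homeomorphism_def)
  have gG: "g (G x) = x" if "x \<in> U" for x
    using hom that by (auto simp: homeomorphism_def)
  obtain U1 U2 where "open U1" "open U2" "z0 \<in> U1 \<times> U2" "U1 \<times> U2 \<subseteq> U"
    by (rule open_prod_elim[OF U])
  then have "open U1" "open U2" "0 \<in> U1" "y0 \<in> U2" "U1 \<times> U2 \<subseteq> U"
    by (auto simp: z0_def)
  then obtain s e where se: "s > 0" "e > 0" "ball 0 s \<times> ball y0 e \<subseteq> U"
    by (meson open_contains_ball Sigma_mono subset_trans)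
  define \<phi> where "\<phi> = (\<lambda>h. snd (g (h, 0)))"
  have \<phi>0: "\<phi> 0 = y0"
    using gG[OF U(2)] unfolding Gz0 by (simp add: \<phi>_def z0_def)
  have g_eq: "g (h, 0) = (h, \<phi> h)" "F (h, \<phi> h) = 0" if "(h, 0) \<in> V" for h
  proof -
    have "fst (g (h, 0)) = h \<and> F (g (h, 0)) = 0"
      using Gg(1)[OF that] by (auto simp: G_def)
    then show "g (h, 0) = (h, \<phi> h)" by (simp add: \<phi>_def prod_eq_iff)
    with \<open>fst (g (h, 0)) = h \<and> F (g (h, 0)) = 0\<close> show "F (h, \<phi> h) = 0" by simp
  qed
  have der\<phi>: "(\<phi> has_field_derivative (- A (h, \<phi> h) / B (h, \<phi> h))) (at h)" if h: "(h, 0) \<in> V" for h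
  proof -
    have bijL: "bij (L (h, \<phi> h))" using bij[OF h] by (simp add: G' g_eq[OF h])
    \<comment> \<open>Invertibility of the derivative persists at the points reached by the inverse map.\<close>
    have Bnz: "B (h, \<phi> h) \<noteq> 0"
    proof
      assume "B (h, \<phi> h) = 0"
      then have "L (h, \<phi> h) (0, 1) = L (h, \<phi> h) (0, 0)" by (simp add: L_def)
      then have "(0::complex, 1::complex) = (0, 0)"
        by (rule injD[OF bij_is_inj[OF bijL]])
      then show False by simp
    qed
    have eq: "snd (g' (h, 0) (t, 0)) = - A (h, \<phi> h) / B (h, \<phi> h) * t" for t
    proof -
      let ?v = "g' (h, 0) (t, 0)"
      have "L (h, \<phi> h) ?v = (t, 0)"
        using bijL by (simp add: g'[OF h] G' g_eq[OF h] bij_is_surj surj_f_inv_f)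
      then have "fst ?v = t" "A (h, \<phi> h) * t + B (h, \<phi> h) * snd ?v = 0"
        by (auto simp: L_def)
      then show ?thesis
        using Bnz by (simp add: field_simps eq_neg_iff_add_eq_0)
    qed
    have "((\<lambda>h. (h, 0)) has_derivative (\<lambda>t. (t, 0))) (at h)"
      by (intro has_derivative_Pair has_derivative_ident has_derivative_const)
    from has_derivative_snd[OF has_derivative_compose[OF this derg[OF h]]]
    have "(\<phi> has_derivative (\<lambda>t. snd (g' (h, 0) (t, 0)))) (at h)"
      by (simp add: \<phi>_def)
    then show ?thesis unfolding has_field_derivative_def eq .
  qed
  have V0: "(0, 0) \<in> V" using V Gz0 by simp
  have "eventually (\<lambda>h. (h, 0) \<in> V) (nhds 0)"
  proof -
    obtain V1 V2 where "open V1" "open V2" "(0, 0) \<in> V1 \<times> V2" "V1 \<times> V2 \<subseteq> V"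
      by (rule open_prod_elim[OF V(1) V0])
    then show ?thesis by (auto simp: eventually_nhds intro!: exI[of _ V1])
  qed
  moreover have "eventually (\<lambda>h. \<phi> h \<in> ball y0 e) (nhds 0)"
  proof -
    have "isCont \<phi> 0" using der\<phi>[OF V0] DERIV_isCont by blast
    then have "(\<phi> \<longlongrightarrow> y0) (nhds 0)"
      by (simp add: \<phi>0 continuous_at tendsto_nhds_iff)
    then show ?thesis
      by (rule topological_tendstoD) (use se in auto)
  qed
  ultimately have "eventually (\<lambda>h. (h, 0) \<in> V \<and> \<phi> h \<in> ball y0 e) (nhds 0)"
    by eventually_elim simp
  then obtain r0 where r0: "r0 > 0" "\<And>h. dist h 0 < r0 \<Longrightarrow> (h, 0) \<in> V \<and> \<phi> h \<in> ball y0 e"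
    unfolding eventually_nhds_metric by blast
  define r where "r = min r0 s"
  have r: "r > 0" "\<And>h. h \<in> ball 0 r \<Longrightarrow> (h, 0) \<in> V \<and> \<phi> h \<in> ball y0 e"
    using r0 se by (auto simp: r_def dist_commute)
  show ?thesis
  proof (rule that[of r e \<phi>])
    show "\<phi> holomorphic_on ball 0 r"
      unfolding holomorphic_on_open[OF open_ball] using der\<phi> r(2) by blast
    show "deriv \<phi> 0 = - A (0, y0) / B (0, y0)"
      using DERIV_imp_deriv[OF der\<phi>[OF V0]] by (simp add: \<phi>0)
    fix h y assume *: "h \<in> ball 0 r" "y \<in> ball y0 e" "F (h, y) = 0"
    then have "(h, y) \<in> U" using se(3) by (auto simp: r_def)
    from gG[OF this] show "y = \<phi> h" using * by (simp add: G_def \<phi>_def)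
  qed (use r se \<phi>0 g_eq in auto)
qed

text \<open>
  The conjugate of \<open>\<phi>(h)\<close> is another zero near \<open>y0\<close> when \<open>h\<close> is real, so by local uniqueness \<open>\<phi>(h)\<close> is
  real. Its Taylor series has no linear term, because the derivative at \<open>0\<close> is a multiple of \<open>A (0, y0)\<close>.
\<close>

lemma real_zero_branch:
  fixes F :: "complex \<times> complex \<Rightarrow> complex" and y0 :: real
  assumes F: "holo_partials F A B"
    and sym: "\<And>h y. F (cnj h, cnj y) = cnj (F (h, y))"
    and zero: "F (0, of_real y0) = 0"
    and A0: "A (0, of_real y0) = 0" and B0: "B (0, of_real y0) \<noteq> 0"
  shows "\<exists>r \<psi> a. r > 0 \<and> (\<psi> \<longlongrightarrow> y0) (at (0::real)) \<and>
    (\<forall>h. \<bar>h\<bar> < r \<longrightarrow> F (of_real h, of_real (\<psi> h)) = 0 \<and>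
       (\<lambda>j. a j * h ^ (j + 2)) sums (\<psi> h - y0))"
proof -
  obtain r e \<phi> where r: "r > 0" "e > 0" and hol: "\<phi> holomorphic_on ball 0 r"
    and \<phi>0: "\<phi> 0 = of_real y0"
    and d0: "deriv \<phi> 0 = - A (0, of_real y0) / B (0, of_real y0)"
    and F0: "\<And>h. h \<in> ball 0 r \<Longrightarrow> F (h, \<phi> h) = 0"
    and near: "\<And>h. h \<in> ball 0 r \<Longrightarrow> \<phi> h \<in> ball (of_real y0) e"
    and uniq: "\<And>h y. h \<in> ball 0 r \<Longrightarrow> y \<in> ball (of_real y0) e \<Longrightarrow> F (h, y) = 0 \<Longrightarrow> y = \<phi> h"
    by (rule holomorphic_implicit_function[OF F zero B0]) blast
  define \<psi> where "\<psi> = (\<lambda>h::real. Re (\<phi> (of_real h)))"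
  have real: "\<phi> (of_real h) = of_real (\<psi> h)" if "\<bar>h\<bar> < r" for h
  proof -
    have h: "of_real h \<in> ball (0::complex) r" using that by simp
    have "dist (of_real y0) (cnj (\<phi> (of_real h))) = dist (of_real y0) (\<phi> (of_real h))"
      unfolding dist_norm by (metis complex_cnj_complex_of_real complex_cnj_diff complex_mod_cnj)
    then have "cnj (\<phi> (of_real h)) \<in> ball (of_real y0) e" using near[OF h] by simp
    moreover have "F (of_real h, cnj (\<phi> (of_real h))) = 0"
      using sym[of "of_real h" "\<phi> (of_real h)"] F0[OF h] by simp
    ultimately have "cnj (\<phi> (of_real h)) = \<phi> (of_real h)" by (rule uniq[OF h])
    then have "\<phi> (of_real h) \<in> \<real>" by (simp add: Reals_cnj_iff)
    then show ?thesis by (simp add: \<psi>_def of_real_Re)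
  qed
  define c where "c = (\<lambda>j. (deriv ^^ j) \<phi> 0 / fact j)"
  have c01: "c 0 = of_real y0" "c 1 = 0"
    using d0 A0 by (simp_all add: c_def \<phi>0)
  have cont: "(\<psi> \<longlongrightarrow> y0) (at 0)"
  proof -
    have "continuous_on (ball 0 r) \<phi>" using hol holomorphic_on_imp_continuous_on by blast
    then have "isCont \<phi> (of_real 0)"
      using r by (simp add: continuous_on_eq_continuous_at)
    then have "isCont (\<lambda>h::real. \<phi> (of_real h)) 0"
      by (rule isCont_o2[OF isCont_of_real[OF continuous_ident]])
    then have "isCont \<psi> 0"
      unfolding \<psi>_def by (rule continuous_Re)
    then show ?thesis
      by (simp add: isCont_def \<psi>_def \<phi>0)
  qed
  have zeros: "F (of_real h, of_real (\<psi> h)) = 0" if h: "\<bar>h\<bar> < r" for h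
    using F0[of "of_real h"] real[OF h] h by simp
  have series: "(\<lambda>j. Re (c (j + 2)) * h ^ (j + 2)) sums (\<psi> h - y0)" if h: "\<bar>h\<bar> < r" for h
  proof -
    have hb: "of_real h \<in> ball (0::complex) r" using h by simp
    have "(\<lambda>j. c j * of_real h ^ j) sums of_real (\<psi> h)"
      using holomorphic_power_series[OF hol hb] by (simp add: c_def real[OF h])
    then have "(\<lambda>j. Re (c j * of_real h ^ j)) sums Re (of_real (\<psi> h))"
      by (rule sums_Re)
    moreover have "Re (c j * of_real h ^ j) = Re (c j) * h ^ j" for j
      unfolding of_real_power[symmetric] by simp
    ultimately have "(\<lambda>j. Re (c j) * h ^ j) sums \<psi> h"
      by simp
    then have "(\<lambda>j. Re (c (j + 2)) * h ^ (j + 2)) sums (\<psi> h - (\<Sum>j<2. Re (c j) * h ^ j))"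
      by (rule sums_split_initial_segment)
    moreover have "(\<Sum>j<2. Re (c j) * h ^ j) = y0"
      using c01 by (simp add: lessThan_nat_numeral lessThan_Suc)
    ultimately show ?thesis by simp
  qed
  show ?thesis
    using r(1) cont zeros series
    by (intro exI[of _ r] exI[of _ \<psi>] exI[of _ "\<lambda>j. Re (c (j + 2))"]) simp
qed

section \<open>Zeros in increasing order and their perturbation\<close>

lemma kth_zero_eqI:
  assumes "strict_mono_on {..<n} z" "{x. f x = 0} = z ` {..<n}" "1 \<le> k" "k \<le> n"
  shows "kth_zero f k = z (k - 1)"
proof -
  let ?xs = "map z [0..<n]"
  have "sorted_wrt (<) ?xs"
    using assms(1) by (auto simp: sorted_wrt_iff_nth_less strict_mono_on_def)
  moreover have "set ?xs = {x. f x = 0}"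
    using assms(2) by (simp add: atLeast0LessThan)
  ultimately have "sorted_list_of_set {x. f x = 0} = ?xs"
    by (metis sorted_list_of_set.idem_if_sorted_distinct strict_sorted_iff)
  then show ?thesis using assms(3,4) by (simp add: kth_zero_def)
qed

lemma kth_zero_enumeration:
  assumes "card {x. f x = 0} = n" "n \<ge> 1"
  obtains z where "strict_mono_on {..<n} z" "{x. f x = 0} = z ` {..<n}"
    "\<And>k. 1 \<le> k \<Longrightarrow> k \<le> n \<Longrightarrow> kth_zero f k = z (k - 1)"
proof -
  define xs where "xs = sorted_list_of_set {x. f x = 0}"
  have fin: "finite {x. f x = 0}" by (rule card_ge_0_finite) (use assms in simp)
  have len: "length xs = n" using assms by (simp add: xs_def)
  have "strict_mono_on {..<n} ((!) xs)"
    using strict_sorted_list_of_set[of "{x. f x = 0}"] len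
    by (auto simp: strict_mono_on_def sorted_wrt_iff_nth_less xs_def)
  moreover have "{x. f x = 0} = (!) xs ` {..<n}"
    using set_sorted_list_of_set[OF fin] len
    by (metis xs_def atLeast0LessThan list.set_map map_nth set_upt)
  ultimately show ?thesis using that kth_zero_eqI by blast
qed

lemma kth_zero_mono_image:
  assumes "card {x. f x = 0} = n" "n \<ge> 1" "1 \<le> k" "k \<le> n"
    and "{x. g x = 0} = \<psi> ` {x. f x = 0}" "strict_mono_on {x. f x = 0} \<psi>"
  shows "kth_zero g k = \<psi> (kth_zero f k)"
proof -
  obtain z where z: "strict_mono_on {..<n} z" "{x. f x = 0} = z ` {..<n}"
    "\<And>k. 1 \<le> k \<Longrightarrow> k \<le> n \<Longrightarrow> kth_zero f k = z (k - 1)"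
    using kth_zero_enumeration[OF assms(1,2)] by blast
  have "strict_mono_on {..<n} (\<psi> \<circ> z)"
    using z(1) assms(6) unfolding z(2) strict_mono_on_def by auto
  moreover have "{x. g x = 0} = (\<psi> \<circ> z) ` {..<n}"
    by (simp add: assms(5) z(2) image_comp)
  ultimately show ?thesis
    using kth_zero_eqI[of n "\<psi> \<circ> z" g k] z(3) assms(3,4) by simp
qed

lemma kth_zero_antimono_image:
  assumes "card {x. f x = 0} = n" "n \<ge> 1" "1 \<le> k" "k \<le> n"
    and "{x. g x = 0} = \<psi> ` {x. f x = 0}"
    and "\<And>x y. f x = 0 \<Longrightarrow> f y = 0 \<Longrightarrow> x < y \<Longrightarrow> \<psi> y < \<psi> x"
  shows "kth_zero g k = \<psi> (kth_zero f (n + 1 - k))"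
proof -
  obtain z where z: "strict_mono_on {..<n} z" "{x. f x = 0} = z ` {..<n}"
    "\<And>k. 1 \<le> k \<Longrightarrow> k \<le> n \<Longrightarrow> kth_zero f k = z (k - 1)"
    using kth_zero_enumeration[OF assms(1,2)] by blast
  define w where "w = (\<lambda>i. \<psi> (z (n - 1 - i)))"
  have "strict_mono_on {..<n} w"
  proof (rule strict_mono_onI)
    fix i j assume "i \<in> {..<n}" "j \<in> {..<n}" "i < j"
    then have "z (n - 1 - j) < z (n - 1 - i)"
      by (intro strict_mono_onD[OF z(1)]) auto
    moreover have "f (z (n - 1 - j)) = 0" "f (z (n - 1 - i)) = 0"
      using z(2) \<open>j \<in> {..<n}\<close> by auto
    ultimately show "w i < w j" unfolding w_def by (intro assms(6))
  qed
  moreover have "(\<lambda>i. n - 1 - i) ` {..<n} = {..<n}"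
  proof (rule set_eqI, rule iffI)
    fix i assume "i \<in> {..<n}"
    then show "i \<in> (\<lambda>i. n - 1 - i) ` {..<n}"
      by (intro image_eqI[of _ _ "n - 1 - i"]) auto
  qed auto
  then have "{x. g x = 0} = w ` {..<n}"
    unfolding assms(5) z(2) w_def by (metis (no_types) image_image)
  ultimately show ?thesis
    using kth_zero_eqI[of n w g k] z(3)[of "n + 1 - k"] assms(3,4)
    by (auto simp: w_def Suc_diff_le)
qed

text \<open>
  A double zero would leave fewer than \<open>n\<close> distinct ones.
\<close>

lemma pderiv_nonzero_at_simple_zero:
  fixes p :: "'a::field_char_0 poly"
  assumes "degree p \<le> n" "card {x. poly p x = 0} = n" "n \<ge> 1" "poly p a = 0"
  shows "poly (pderiv p) a \<noteq> 0"
proof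
  assume d: "poly (pderiv p) a = 0"
  have p0: "p \<noteq> 0" using assms(2,3) infinite_UNIV_char_0[where 'a = 'a] by auto
  obtain q where q: "p = [:- a, 1:] * q" using assms(4) by (auto simp: poly_eq_0_iff_dvd)
  have "poly q a = 0" using d unfolding q pderiv_mult by (simp add: pderiv_pCons)
  then have "{x. poly p x = 0} \<subseteq> {x. poly q x = 0}" by (auto simp: q)
  moreover have q0: "q \<noteq> 0" using p0 q by auto
  ultimately have "n \<le> card {x. poly q x = 0}"
    using assms(2) card_mono[OF poly_roots_finite[OF q0]] by auto
  also have "\<dots> \<le> degree q" by (rule card_poly_roots_bound[OF q0])
  also have "\<dots> < degree p" using q0 unfolding q by (subst degree_mult_eq) auto
  finally show False using assms(1) by simp
qed

text \<open>
  Each zero \<open>z i\<close> of \<open>f 0\<close> is simple and continues to an analytic branch \<open>\<psi> i\<close>. Near \<open>h = 0\<close> the branches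
  keep the order of their limits, and being \<open>n\<close> distinct zeros of a nonzero polynomial of degree
  at most \<open>n\<close> they are all of its zeros, so the \<open>k\<close>-th zero follows the \<open>k\<close>-th branch.
\<close>

theorem kth_zero_perturbation:
  fixes F :: "complex \<times> complex \<Rightarrow> complex" and f :: "real \<Rightarrow> real \<Rightarrow> real"
  assumes F: "jointly_holomorphic F"
    and sym: "\<And>h y. F (cnj h, cnj y) = cnj (F (h, y))"
    and Ff: "\<And>h y. F (of_real h, of_real y) = of_real (f h y)"
    and pol: "\<And>h. \<exists>p. degree p \<le> n \<and> f h = poly p"
    and card: "card {y. f 0 y = 0} = n"
    and der: "\<And>y. ((\<lambda>h. f h y) has_real_derivative 0) (at 0)"
    and k: "1 \<le> k" "k \<le> n"
  obtains a where
    "\<forall>\<^sub>F h in at 0. card {y. f h y = 0} = n \<and>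
       (\<lambda>j. a j * h ^ (j + 2)) sums (kth_zero (f h) k - kth_zero (f 0) k)"
proof -
  have n: "n \<ge> 1" using k by simp
  obtain A B where AB: "holo_partials F A B" using F by (auto simp: jointly_holomorphic_def)
  obtain p where p: "degree p \<le> n" "f 0 = poly p" using pol by blast
  obtain z where z: "strict_mono_on {..<n} z" "{y. f 0 y = 0} = z ` {..<n}"
    "\<And>k. 1 \<le> k \<Longrightarrow> k \<le> n \<Longrightarrow> kth_zero (f 0) k = z (k - 1)"
    using kth_zero_enumeration[OF card n] by blast
  have A0: "A (0, of_real y) = 0" for y
  proof -
    have "((\<lambda>h. (complex_of_real h, complex_of_real y)) has_derivative (\<lambda>t. (of_real t, 0))) (at (0::real))"
      by (intro has_derivative_Pair has_derivative_const has_derivative_of_real has_derivative_ident)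
    moreover have "(F has_derivative (\<lambda>v. A (0, of_real y) * fst v + B (0, of_real y) * snd v))
        (at (of_real 0, of_real y))"
      using holo_partials_D(3)[OF AB, of "(0, of_real y)"] by simp
    ultimately have "((\<lambda>h. F (of_real h, of_real y)) has_derivative
        (\<lambda>t. A (0, of_real y) * fst (complex_of_real t, 0::complex) + B (0, of_real y) * snd (complex_of_real t, 0::complex))) (at (0::real))"
      by (rule has_derivative_compose[where g = F])
    then have "((\<lambda>h. of_real (f h y)) has_derivative (\<lambda>t. A (0, of_real y) * of_real t)) (at (0::real))"
      by (simp add: Ff)
    moreover have "((\<lambda>h. complex_of_real (f h y)) has_derivative (\<lambda>t. of_real (0 * t))) (at (0::real))"
      using der[of y] unfolding has_field_derivative_def by (rule has_derivative_of_real)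
    ultimately have "(\<lambda>t::real. A (0, of_real y) * of_real t) = (\<lambda>t. of_real (0 * t))"
      by (rule has_derivative_unique)
    from fun_cong[OF this, of 1] show ?thesis by simp
  qed
  have B0: "B (0, of_real y) = of_real (poly (pderiv p) y)" for y
  proof -
    have "((\<lambda>y. (0::complex, complex_of_real y)) has_derivative (\<lambda>t. (0, of_real t))) (at y)"
      by (intro has_derivative_Pair has_derivative_const has_derivative_of_real has_derivative_ident)
    from has_derivative_compose[OF this holo_partials_D(3)[OF AB, of "(0, of_real y)"]]
    have "((\<lambda>y. of_real (f 0 y)) has_derivative (\<lambda>t. B (0, of_real y) * of_real t)) (at y)"
      using Ff[of 0] by simp
    moreover have "((\<lambda>y. complex_of_real (f 0 y)) has_derivative (\<lambda>t. of_real (poly (pderiv p) y * t))) (at y)"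
      using poly_DERIV[of p y] unfolding has_field_derivative_def p(2) by (rule has_derivative_of_real)
    ultimately have "(\<lambda>t::real. B (0, of_real y) * of_real t) = (\<lambda>t. of_real (poly (pderiv p) y * t))"
      by (rule has_derivative_unique)
    from fun_cong[OF this, of 1] show ?thesis by simp
  qed
  define branch where "branch = (\<lambda>i r \<psi> a. r > 0 \<and> (\<psi> \<longlongrightarrow> z i) (at (0::real)) \<and>
      (\<forall>h. \<bar>h\<bar> < r \<longrightarrow> f h (\<psi> h) = 0 \<and> (\<lambda>j. a j * h ^ (j + 2)) sums (\<psi> h - z i)))"
  have "\<exists>r \<psi> a. branch i r \<psi> a"
    if i: "i < n" for i
  proof -
    have zi: "f 0 (z i) = 0" using z(2) i by blast
    have Bz: "B (0, of_real (z i)) \<noteq> 0"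
      using pderiv_nonzero_at_simple_zero[OF p(1) _ n, of "z i"] card zi unfolding B0 p(2) by simp
    have Fz: "F (0, of_real (z i)) = 0" using Ff[of 0 "z i"] zi by simp
    show ?thesis
      using real_zero_branch[OF AB sym Fz A0 Bz] by (simp add: branch_def Ff)
  qed
  then obtain r \<psi> a where branch: "\<And>i. i < n \<Longrightarrow> branch i (r i) (\<psi> i) (a i)"
    by metis
  have r: "\<And>i. i < n \<Longrightarrow> r i > 0"
    and lim: "\<And>i. i < n \<Longrightarrow> (\<psi> i \<longlongrightarrow> z i) (at (0::real))"
    and zero: "\<And>i h. i < n \<Longrightarrow> \<bar>h\<bar> < r i \<Longrightarrow> f h (\<psi> i h) = 0"
    and ser: "\<And>i h. i < n \<Longrightarrow> \<bar>h\<bar> < r i \<Longrightarrow> (\<lambda>j. a i j * h ^ (j + 2)) sums (\<psi> i h - z i)"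
    using branch unfolding branch_def by simp_all
  have "\<forall>\<^sub>F h in at 0. \<bar>h\<bar> < r i" if "i < n" for i
    using r[OF that] by (auto simp: eventually_at intro!: exI[of _ "r i"])
  then have ev_r: "\<forall>\<^sub>F h in at 0. \<forall>i\<in>{..<n}. \<bar>h\<bar> < r i"
    by (simp add: eventually_ball_finite_distrib)
  \<comment> \<open>Two distinct limits are separated by a point \<open>m\<close>, which then also separates the branches.\<close>
  have "\<forall>\<^sub>F h in at 0. \<psi> i h < \<psi> j h" if "i < j" "j < n" for i j
  proof -
    have "z i < z j" using strict_mono_onD[OF z(1)] that by auto
    from dense[OF this] obtain m where m: "z i < m" "m < z j" by blast
    have "\<forall>\<^sub>F h in at 0. \<psi> i h < m" "\<forall>\<^sub>F h in at 0. m < \<psi> j h"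
      using order_tendstoD(2)[OF lim m(1)] order_tendstoD(1)[OF lim m(2)] that by auto
    then show ?thesis by eventually_elim simp
  qed
  then have "\<forall>\<^sub>F h in at 0. i < j \<longrightarrow> \<psi> i h < \<psi> j h" if "j < n" for i j
    using that by (cases "i < j") simp_all
  then have "\<forall>\<^sub>F h in at 0. \<forall>i\<in>{..<n}. \<forall>j\<in>{..<n}. i < j \<longrightarrow> \<psi> i h < \<psi> j h"
    by (simp add: eventually_ball_finite_distrib)
  \<comment> \<open>A point to the left of all zeros of \<open>f 0\<close> witnesses that \<open>f h\<close> is not the zero polynomial.\<close>
  moreover have "\<forall>\<^sub>F h in at 0. f h (z 0 - 1) \<noteq> 0"
  proof -
    have "f 0 (z 0 - 1) \<noteq> 0"
    proof
      assume "f 0 (z 0 - 1) = 0"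
      then obtain i where i: "i < n" "z i = z 0 - 1" using z(2) by (metis (mono_tags) imageE lessThan_iff mem_Collect_eq)
      have "z 0 \<le> z i" using strict_mono_onD[OF z(1), of 0 i] i by (cases "i = 0") auto
      with i show False by simp
    qed
    moreover have "((\<lambda>h. f h (z 0 - 1)) \<longlongrightarrow> f 0 (z 0 - 1)) (at 0)"
      using DERIV_isCont[OF der] by (simp add: isCont_def)
    ultimately show ?thesis by (rule tendsto_imp_eventually_ne[rotated])
  qed
  ultimately have "\<forall>\<^sub>F h in at 0. card {y. f h y = 0} = n \<and>
       (\<lambda>j. a (k - 1) j * h ^ (j + 2)) sums (kth_zero (f h) k - kth_zero (f 0) k)"
    using ev_r
  proof eventually_elim
    case (elim h)
    have mono: "strict_mono_on {..<n} (\<lambda>i. \<psi> i h)"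
      using elim(1) by (auto intro: strict_mono_onI)
    obtain q where q: "degree q \<le> n" "f h = poly q" using pol by blast
    have q0: "q \<noteq> 0" using elim(2) q(2) by auto
    have inj: "inj_on (\<lambda>i. \<psi> i h) {..<n}" by (rule strict_mono_on_imp_inj_on[OF mono])
    have sub: "(\<lambda>i. \<psi> i h) ` {..<n} \<subseteq> {y. f h y = 0}" using zero elim(3) by auto
    have fin: "finite {y. f h y = 0}" unfolding q(2) by (rule poly_roots_finite[OF q0])
    have "card {y. f h y = 0} \<le> n"
      unfolding q(2) using card_poly_roots_bound[OF q0] q(1) by linarith
    then have eq: "{y. f h y = 0} = (\<lambda>i. \<psi> i h) ` {..<n}"
      using card_seteq[OF fin sub] card_image[OF inj] by simp
    have "kth_zero (f h) k = \<psi> (k - 1) h"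
      by (rule kth_zero_eqI[where n = n and z = "\<lambda>i. \<psi> i h"]) (use mono eq k in simp_all)
    moreover have "k - 1 < n" using k by simp
    ultimately show ?case
      using ser[of "k - 1" h] elim(3) z(3)[OF k] card_image[OF inj] by (simp add: eq)
  qed
  then show ?thesis by (rule that)
qed

section \<open>The Hermite limit\<close>

text \<open>
  This is \<open>h\<^sup>n\<close> times the continuant of \<open>CRR_eq_continuant\<close> at \<open>\<lambda> = 1/h\<^sup>2\<close> and \<open>x = h(y + \<eta>h)\<close>, with all negative powers of \<open>h\<close>
  cancelled. The shift by \<open>\<eta>h\<close> removes the term \<open>-2\<eta>h\<close>, the only one linear in \<open>h\<close>,
  and accounts for the summand \<open>\<eta>/\<lambda>\<close> of the expansion.
\<close>

definition hermite_pencil :: "real \<Rightarrow> nat \<Rightarrow> 'a::{comm_ring_1, real_algebra_1} \<Rightarrow> 'a \<Rightarrow> 'a" where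
  "hermite_pencil \<eta> n h y = continuant
     (\<lambda>m. 2 * y + 2 * of_nat m * h\<^sup>2 * (y + of_real \<eta> * h))
     (\<lambda>m. of_nat m * ((of_nat m - 1) * h\<^sup>2 + 2) * (h\<^sup>2 * (y + of_real \<eta> * h)\<^sup>2 + 1)) n"

lemma hermite_pencil_0: "hermite_pencil \<eta> n 0 = poly (hermite n)"
proof
  fix y :: real
  show "hermite_pencil \<eta> n 0 y = poly (hermite n) y"
    unfolding hermite_pencil_def hermite_eq_continuant poly_continuant by (simp add: mult_ac)
qed

lemma hermite_zero_expansion:
  assumes "1 \<le> k" "k \<le> n"
  obtains a where "\<forall>\<^sub>F h in at 0. card {y. hermite_pencil \<eta> n h y = 0} = n \<and>
    (\<lambda>j. a j * h ^ (j + 2)) sums (kth_zero (hermite_pencil \<eta> n h) k - kth_zero (poly (hermite n)) k)"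
proof -
  let ?F = "\<lambda>z::complex \<times> complex. hermite_pencil \<eta> n (fst z) (snd z)"
  have "jointly_holomorphic ?F"
    unfolding hermite_pencil_def
    by (intro jointly_holomorphic_continuant jointly_holomorphic_intros)
  moreover have "?F (cnj h, cnj y) = cnj (?F (h, y))" for h y
    by (simp add: hermite_pencil_def continuant_cnj)
  moreover have "?F (of_real h, of_real y) = of_real (hermite_pencil \<eta> n h y)" for h y
    by (simp add: hermite_pencil_def continuant_of_real)
  moreover have "\<exists>p. degree p \<le> n \<and> hermite_pencil \<eta> n h = poly p" for h :: real
  proof -
    define a where "a = (\<lambda>m. [:2 * of_nat m * h\<^sup>2 * (\<eta> * h), 2 + 2 * of_nat m * h\<^sup>2:])"
    define b where "b = (\<lambda>m. smult (of_nat m * ((of_nat m - 1) * h\<^sup>2 + 2))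
                           ([:h * (\<eta> * h), h:] ^ 2 + 1))"
    have "degree (a m) \<le> 1" for m by (simp add: a_def)
    moreover have "degree (b m) \<le> 2" for m
      unfolding b_def
      by (intro order.trans[OF degree_smult_le] degree_add_le order.trans[OF degree_power_le]) auto
    moreover have "hermite_pencil \<eta> n h y = poly (continuant a b n) y" for y
      unfolding hermite_pencil_def poly_continuant
      by (simp add: a_def b_def algebra_simps power2_eq_square)
    ultimately show ?thesis using degree_continuant_le by blast
  qed
  moreover have "card {y. hermite_pencil \<eta> n (0::real) y = 0} = n"
    by (simp add: hermite_pencil_0 card_zeros_hermite)
  moreover have "((\<lambda>h. hermite_pencil \<eta> n h y) has_real_derivative 0) (at 0)" for y
    unfolding hermite_pencil_def
    by (rule continuant_has_derivative_0) (auto intro!: derivative_eq_intros)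
  ultimately show ?thesis
    using kth_zero_perturbation[of ?F "hermite_pencil \<eta> n" n k] assms that
    by (simp only: hermite_pencil_0) blast
qed

lemma CRR_eq_0_iff_hermite_pencil:
  assumes "h > 0"
  shows "CRR (Complex (1 / h\<^sup>2) \<eta>) n (h * (y + \<eta> * h)) = 0 \<longleftrightarrow> hermite_pencil \<eta> n h y = 0"
proof -
  let ?lam = "1 / h\<^sup>2" and ?x = "h * (y + \<eta> * h)"
  let ?K = "continuant (\<lambda>m. 2 * (of_nat m + ?lam) * ?x - 2 * \<eta>)
                (\<lambda>m. of_nat m * (of_nat m - 1 + 2 * ?lam) * (?x\<^sup>2 + 1)) n"
  have lam: "?lam > 0" using assms by simp
  have a: "h * (2 * (of_nat m + ?lam) * ?x - 2 * \<eta>) = 2 * y + 2 * of_nat m * h\<^sup>2 * (y + \<eta> * h)" for m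
    using assms by (simp add: field_simps power2_eq_square)
  have b: "h\<^sup>2 * (of_nat m * (of_nat m - 1 + 2 * ?lam) * (?x\<^sup>2 + 1)) =
     of_nat m * ((of_nat m - 1) * h\<^sup>2 + 2) * (h\<^sup>2 * (y + \<eta> * h)\<^sup>2 + 1)" for m
  proof -
    have "h\<^sup>2 * (of_nat m - 1 + 2 * ?lam) = (of_nat m - 1) * h\<^sup>2 + 2"
      using assms by (simp add: field_simps)
    moreover have "h\<^sup>2 * (of_nat m * (of_nat m - 1 + 2 * ?lam) * (?x\<^sup>2 + 1)) =
        of_nat m * (h\<^sup>2 * (of_nat m - 1 + 2 * ?lam)) * (?x\<^sup>2 + 1)"
      by (simp only: mult_ac)
    ultimately show ?thesis by (simp only: power_mult_distrib)
  qed
  have "hermite_pencil \<eta> n h y = h ^ n * ?K"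
    unfolding hermite_pencil_def continuant_scale[symmetric] a b by simp
  moreover have "pochhammer ?lam n \<noteq> 0" using pochhammer_pos[OF lam, of n] by simp
  ultimately show ?thesis
    using assms by (simp add: CRR_eq_continuant[OF lam])
qed

lemma kth_zero_CRR_hermite_scaling:
  assumes "lam > 0" "h = 1 / sqrt lam" "card {y. hermite_pencil \<eta> n h y = 0} = n" "1 \<le> k" "k \<le> n"
  shows "kth_zero (CRR (Complex lam \<eta>) n) k = h * (kth_zero (hermite_pencil \<eta> n h) k + \<eta> * h)"
proof (rule kth_zero_mono_image[where \<psi> = "\<lambda>y. h * (y + \<eta> * h)"])
  have h: "h > 0" "lam = 1 / h\<^sup>2" using assms(1,2) by (auto simp: power_divide)
  show "{x. CRR (Complex lam \<eta>) n x = 0} = (\<lambda>y. h * (y + \<eta> * h)) ` {y. hermite_pencil \<eta> n h y = 0}"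
  proof (intro set_eqI iffI)
    fix x assume "x \<in> {x. CRR (Complex lam \<eta>) n x = 0}"
    moreover have "x = h * ((x / h - \<eta> * h) + \<eta> * h)" using h(1) by simp
    ultimately show "x \<in> (\<lambda>y. h * (y + \<eta> * h)) ` {y. hermite_pencil \<eta> n h y = 0}"
      unfolding h(2) using CRR_eq_0_iff_hermite_pencil[OF h(1), of \<eta> n "x / h - \<eta> * h"]
      by (intro image_eqI[of _ _ "x / h - \<eta> * h"]) auto
  next
    fix x assume "x \<in> (\<lambda>y. h * (y + \<eta> * h)) ` {y. hermite_pencil \<eta> n h y = 0}"
    then show "x \<in> {x. CRR (Complex lam \<eta>) n x = 0}"
      unfolding h(2) using CRR_eq_0_iff_hermite_pencil[OF h(1)] by auto
  qed
  show "strict_mono_on {y. hermite_pencil \<eta> n h y = 0} (\<lambda>y. h * (y + \<eta> * h))"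
    using h(1) by (auto intro: strict_mono_onI)
qed (use assms in auto)

lemma filterlim_inverse_sqrt_at_0: "filterlim (\<lambda>lam. 1 / sqrt lam) (at 0) at_top"
proof -
  have "((\<lambda>lam. inverse (sqrt lam)) \<longlongrightarrow> 0) at_top"
    by (intro tendsto_inverse_0_at_top sqrt_at_top)
  moreover have "\<forall>\<^sub>F lam in at_top. 1 / sqrt lam \<noteq> 0"
    using eventually_gt_at_top[of 0] by eventually_elim simp
  ultimately show ?thesis by (simp add: filterlim_at inverse_eq_divide)
qed

section \<open>The Laguerre limit\<close>

text \<open>
  This is \<open>h\<^sup>n\<close> times the continuant of \<open>CRR_eq_continuant\<close> at \<open>\<eta> = 1/h\<close> and \<open>x = u/h\<close>.
\<close>

definition laguerre_pencil :: "real \<Rightarrow> nat \<Rightarrow> 'a::{comm_ring_1, real_algebra_1} \<Rightarrow> 'a \<Rightarrow> 'a" where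
  "laguerre_pencil lam n h u = continuant
     (\<lambda>m. 2 * (of_nat m + of_real lam) * u - 2)
     (\<lambda>m. of_nat m * (of_nat m - 1 + 2 * of_real lam) * (u\<^sup>2 + h\<^sup>2)) n"

lemma laguerre_pencil_0:
  assumes "u \<noteq> 0"
  shows "laguerre_pencil lam n 0 u = u ^ n * (fact n * poly (laguerre (2 * lam - 1) n) (2 / u))"
proof -
  have a: "u * (2 * of_nat m + 1 + (2 * lam - 1) - 2 / u) = 2 * (of_nat m + lam) * u - 2" for m
    using assms by (simp add: field_simps)
  have b: "u\<^sup>2 * (of_nat m * (of_nat m + (2 * lam - 1))) =
      of_nat m * (of_nat m - 1 + 2 * lam) * (u\<^sup>2 + 0\<^sup>2)" for m
    by (simp add: algebra_simps)
  show ?thesis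
    unfolding laguerre_pencil_def laguerre_eq_continuant continuant_scale[symmetric] a b by simp
qed

text \<open>
  All coefficients \<open>b\<close> vanish at the origin. So the point \<open>u = 0\<close>, which has no counterpart \<open>2/u\<close>, is not a zero.
\<close>

lemma laguerre_pencil_0_0: "laguerre_pencil lam n (0::real) 0 = (-2) ^ n"
  unfolding laguerre_pencil_def
  by (rule continuant_eqI) auto

lemma laguerre_pencil_0_zeros:
  assumes "lam > 0"
  shows "{u::real. laguerre_pencil lam n 0 u = 0} = (\<lambda>l. 2 / l) ` {l. poly (laguerre (2 * lam - 1) n) l = 0}"
proof -
  have pos: "l > 0" if "poly (laguerre (2 * lam - 1) n) l = 0" for l
    using that laguerre_pos[of "2 * lam - 1" l n] assms by (cases "l \<le> 0") auto
  show ?thesis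
  proof (intro set_eqI iffI)
    fix u :: real assume "u \<in> {u. laguerre_pencil lam n 0 u = 0}"
    then have u: "laguerre_pencil lam n 0 u = 0" by simp
    then have "u \<noteq> 0" by (metis laguerre_pencil_0_0 power_not_zero zero_neq_neg_numeral)
    then show "u \<in> (\<lambda>l. 2 / l) ` {l. poly (laguerre (2 * lam - 1) n) l = 0}"
      using u by (intro image_eqI[of _ _ "2 / u"]) (auto simp: laguerre_pencil_0)
  next
    fix u :: real assume "u \<in> (\<lambda>l. 2 / l) ` {l. poly (laguerre (2 * lam - 1) n) l = 0}"
    then obtain l where l: "u = 2 / l" "poly (laguerre (2 * lam - 1) n) l = 0" by blast
    then show "u \<in> {u. laguerre_pencil lam n 0 u = 0}"
      using pos[OF l(2)] by (simp add: laguerre_pencil_0)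
  qed
qed

text \<open>
  The map \<open>l \<mapsto> 2/l\<close> is decreasing on the positive axis, which reverses the numbering.
\<close>

lemma kth_zero_laguerre_pencil_0:
  assumes "lam > 0" "1 \<le> k" "k \<le> n"
  shows "kth_zero (laguerre_pencil lam n 0) k = 2 / kth_zero (poly (laguerre (2 * lam - 1) n)) (n + 1 - k)"
proof (rule kth_zero_antimono_image[where \<psi> = "\<lambda>l. 2 / l"])
  show "card {x. poly (laguerre (2 * lam - 1) n) x = 0} = n"
    using assms by (intro card_zeros_laguerre) simp
  fix x y assume xy: "poly (laguerre (2 * lam - 1) n) x = 0" "x < y"
  then have "x > 0"
    using laguerre_pos[of "2 * lam - 1" x n] assms by (cases "x \<le> 0") auto
  then show "2 / y < 2 / x" using xy by (simp add: frac_less2)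
qed (use assms laguerre_pencil_0_zeros in auto)

lemma card_zeros_laguerre_pencil_0:
  assumes "lam > 0"
  shows "card {u. laguerre_pencil lam n (0::real) u = 0} = n"
proof -
  have "inj_on (\<lambda>l::real. 2 / l) A" for A by (auto simp: inj_on_def)
  then show ?thesis
    unfolding laguerre_pencil_0_zeros[OF assms]
    using card_zeros_laguerre[of "2 * lam - 1" n] assms by (simp add: card_image)
qed

lemma laguerre_zero_expansion:
  assumes "1 \<le> k" "k \<le> n" "lam > 0"
  obtains a where "\<forall>\<^sub>F h in at 0. card {u. laguerre_pencil lam n h u = 0} = n \<and>
    (\<lambda>j. a j * h ^ (j + 2)) sums (kth_zero (laguerre_pencil lam n h) k - kth_zero (laguerre_pencil lam n 0) k)"
proof -
  let ?F = "\<lambda>z::complex \<times> complex. laguerre_pencil lam n (fst z) (snd z)"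
  have "jointly_holomorphic ?F"
    unfolding laguerre_pencil_def
    by (intro jointly_holomorphic_continuant jointly_holomorphic_intros)
  moreover have "?F (cnj h, cnj y) = cnj (?F (h, y))" for h y
    by (simp add: laguerre_pencil_def continuant_cnj)
  moreover have "?F (of_real h, of_real y) = of_real (laguerre_pencil lam n h y)" for h y
    by (simp add: laguerre_pencil_def continuant_of_real)
  moreover have "\<exists>p. degree p \<le> n \<and> laguerre_pencil lam n h = poly p" for h :: real
  proof -
    define a where "a = (\<lambda>m. [:- 2, 2 * (of_nat m + lam):])"
    define b where "b = (\<lambda>m. smult (of_nat m * (of_nat m - 1 + 2 * lam)) [:h\<^sup>2, 0, 1:])"
    have "degree (a m) \<le> 1" "degree (b m) \<le> 2" for m by (simp_all add: a_def b_def)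
    moreover have "laguerre_pencil lam n h y = poly (continuant a b n) y" for y
      unfolding laguerre_pencil_def poly_continuant
      by (simp add: a_def b_def algebra_simps power2_eq_square)
    ultimately show ?thesis using degree_continuant_le by blast
  qed
  moreover have "card {y. laguerre_pencil lam n (0::real) y = 0} = n"
    by (rule card_zeros_laguerre_pencil_0) fact
  moreover have "((\<lambda>h. laguerre_pencil lam n h y) has_real_derivative 0) (at 0)" for y
    unfolding laguerre_pencil_def
    by (rule continuant_has_derivative_0) (auto intro!: derivative_eq_intros)
  ultimately show ?thesis
    using kth_zero_perturbation[of ?F "laguerre_pencil lam n" n k] assms that by blast
qed

lemma CRR_eq_0_iff_laguerre_pencil:
  assumes "h > 0" "lam > 0"
  shows "CRR (Complex lam (1 / h)) n (u / h) = 0 \<longleftrightarrow> laguerre_pencil lam n h u = 0"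
proof -
  let ?K = "continuant (\<lambda>m. 2 * (of_nat m + lam) * (u / h) - 2 * (1 / h))
                (\<lambda>m. of_nat m * (of_nat m - 1 + 2 * lam) * ((u / h)\<^sup>2 + 1)) n"
  have a: "h * (2 * (of_nat m + lam) * (u / h) - 2 * (1 / h)) = 2 * (of_nat m + lam) * u - 2" for m
    using assms by (simp add: field_simps)
  have b: "h\<^sup>2 * (of_nat m * (of_nat m - 1 + 2 * lam) * ((u / h)\<^sup>2 + 1)) =
     of_nat m * (of_nat m - 1 + 2 * lam) * (u\<^sup>2 + h\<^sup>2)" for m
  proof -
    have "h\<^sup>2 * ((u / h)\<^sup>2 + 1) = u\<^sup>2 + h\<^sup>2"
      using assms by (simp add: field_simps)
    then show ?thesis by (metis mult.left_commute)
  qed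
  have "laguerre_pencil lam n h u = h ^ n * ?K"
    unfolding laguerre_pencil_def continuant_scale[symmetric] a b by simp
  moreover have "pochhammer lam n \<noteq> 0" using pochhammer_pos[OF assms(2), of n] by simp
  ultimately show ?thesis
    using assms by (simp add: CRR_eq_continuant)
qed

lemma kth_zero_CRR_laguerre_scaling:
  assumes "lam > 0" "\<eta> > 0" "card {u. laguerre_pencil lam n (1 / \<eta>) u = 0} = n" "1 \<le> k" "k \<le> n"
  shows "kth_zero (CRR (Complex lam \<eta>) n) k = \<eta> * kth_zero (laguerre_pencil lam n (1 / \<eta>)) k"
proof (rule kth_zero_mono_image[where \<psi> = "\<lambda>u. \<eta> * u"])
  have *: "CRR (Complex lam \<eta>) n (\<eta> * u) = 0 \<longleftrightarrow> laguerre_pencil lam n (1 / \<eta>) u = 0" for u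
    using CRR_eq_0_iff_laguerre_pencil[of "1 / \<eta>" lam n u] assms(1,2) by (simp add: mult.commute)
  show "{x. CRR (Complex lam \<eta>) n x = 0} = (\<lambda>u. \<eta> * u) ` {u. laguerre_pencil lam n (1 / \<eta>) u = 0}"
  proof (intro set_eqI iffI)
    fix x assume "x \<in> {x. CRR (Complex lam \<eta>) n x = 0}"
    then show "x \<in> (\<lambda>u. \<eta> * u) ` {u. laguerre_pencil lam n (1 / \<eta>) u = 0}"
      using *[of "x / \<eta>"] assms(2) by (intro image_eqI[of _ _ "x / \<eta>"]) auto
  qed (auto simp: *)
  show "strict_mono_on {u. laguerre_pencil lam n (1 / \<eta>) u = 0} (\<lambda>u. \<eta> * u)"
    using assms(2) by (auto intro: strict_mono_onI)
qed (use assms in auto)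

lemma filterlim_inverse_at_0: "filterlim (\<lambda>t::real. 1 / t) (at 0) at_top"
proof -
  have "((\<lambda>t::real. inverse t) \<longlongrightarrow> 0) at_top"
    by (intro tendsto_inverse_0_at_top filterlim_ident)
  moreover have "\<forall>\<^sub>F t::real in at_top. 1 / t \<noteq> 0"
    using eventually_gt_at_top[of 0] by eventually_elim simp
  ultimately show ?thesis by (simp add: filterlim_at inverse_eq_divide)
qed

section \<open>Asymptotics of the zeros\<close>

theorem theorem4p2:
  fixes n k :: nat
  assumes "n \<ge> 1" and "1 \<le> k" and "k \<le> n"
  shows "(\<forall>\<eta>::real.
            powers_from 3 (\<lambda>lam. 1 / sqrt lam) at_top
              (\<lambda>lam::real. kth_zero (CRR (Complex lam \<eta>) n) k
                 - (kth_zero (poly (hermite n)) k / sqrt lam + \<eta> / lam)))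
       \<and> (\<forall>lam::real. lam > 0 \<longrightarrow>
            powers_from 1 (\<lambda>\<eta>. 1 / \<eta>) at_top
              (\<lambda>\<eta>::real. kth_zero (CRR (Complex lam \<eta>) n) k
                 - 2 * \<eta> / kth_zero (poly (laguerre (2 * lam - 1) n)) (n + 1 - k)))"
proof (intro conjI allI impI)
  fix \<eta> :: real
  obtain a where "\<forall>\<^sub>F h in at 0. card {y. hermite_pencil \<eta> n h y = 0} = n \<and>
    (\<lambda>j. a j * h ^ (j + 2)) sums (kth_zero (hermite_pencil \<eta> n h) k - kth_zero (poly (hermite n)) k)"
    using hermite_zero_expansion[OF assms(2,3)] by blast
  from eventually_compose_filterlim[OF this filterlim_inverse_sqrt_at_0]
  have "\<forall>\<^sub>F lam in at_top. (\<lambda>j. a j * (1 / sqrt lam) ^ (3 + j)) sums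
      (kth_zero (CRR (Complex lam \<eta>) n) k - (kth_zero (poly (hermite n)) k / sqrt lam + \<eta> / lam))"
    using eventually_gt_at_top[of 0]
  proof eventually_elim
    case (elim lam)
    define h where "h = 1 / sqrt lam"
    have card: "card {y. hermite_pencil \<eta> n h y = 0} = n"
      and sums: "(\<lambda>j. a j * h ^ (j + 2)) sums
        (kth_zero (hermite_pencil \<eta> n h) k - kth_zero (poly (hermite n)) k)"
      using elim(1) by (simp_all add: h_def)
    have h2: "h * h = 1 / lam" using elim(2) by (simp add: h_def)
    have "(\<lambda>j. h * (a j * h ^ (j + 2))) sums
        (h * (kth_zero (hermite_pencil \<eta> n h) k - kth_zero (poly (hermite n)) k))"
      by (rule sums_mult[OF sums])
    also have "(\<lambda>j. h * (a j * h ^ (j + 2))) = (\<lambda>j. a j * h ^ (3 + j))"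
      by (simp add: eval_nat_numeral mult_ac)
    also have "h * (kth_zero (hermite_pencil \<eta> n h) k - kth_zero (poly (hermite n)) k) =
        kth_zero (CRR (Complex lam \<eta>) n) k - (kth_zero (poly (hermite n)) k * h + \<eta> * (h * h))"
      by (simp add: kth_zero_CRR_hermite_scaling[OF elim(2) h_def card assms(2,3)] algebra_simps)
    finally show ?case unfolding h2 by (simp add: h_def)
  qed
  then show "powers_from 3 (\<lambda>lam. 1 / sqrt lam) at_top
      (\<lambda>lam. kth_zero (CRR (Complex lam \<eta>) n) k - (kth_zero (poly (hermite n)) k / sqrt lam + \<eta> / lam))"
    unfolding powers_from_def by blast
next
  fix lam :: real assume lam: "lam > 0"
  let ?l = "kth_zero (poly (laguerre (2 * lam - 1) n)) (n + 1 - k)"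
  obtain a where "\<forall>\<^sub>F h in at 0. card {u. laguerre_pencil lam n h u = 0} = n \<and>
    (\<lambda>j. a j * h ^ (j + 2)) sums (kth_zero (laguerre_pencil lam n h) k - kth_zero (laguerre_pencil lam n 0) k)"
    using laguerre_zero_expansion[OF assms(2,3) lam] by blast
  from eventually_compose_filterlim[OF this filterlim_inverse_at_0]
  have "\<forall>\<^sub>F \<eta> in at_top. (\<lambda>j. a j * (1 / \<eta>) ^ (1 + j)) sums
      (kth_zero (CRR (Complex lam \<eta>) n) k - 2 * \<eta> / ?l)"
    using eventually_gt_at_top[of 0]
  proof eventually_elim
    case (elim \<eta>)
    define h where "h = 1 / \<eta>"
    have card: "card {u. laguerre_pencil lam n (1 / \<eta>) u = 0} = n"
      and sums: "(\<lambda>j. a j * h ^ (j + 2)) sums (kth_zero (laguerre_pencil lam n h) k - 2 / ?l)"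
      using elim(1) by (simp_all add: h_def kth_zero_laguerre_pencil_0[OF lam assms(2,3)])
    have "(\<lambda>j. \<eta> * (a j * h ^ (j + 2))) sums (\<eta> * (kth_zero (laguerre_pencil lam n h) k - 2 / ?l))"
      by (rule sums_mult[OF sums])
    also have "(\<lambda>j. \<eta> * (a j * h ^ (j + 2))) = (\<lambda>j. a j * h ^ (1 + j))"
      using elim(2) by (simp add: h_def eval_nat_numeral)
    also have "\<eta> * (kth_zero (laguerre_pencil lam n h) k - 2 / ?l) =
        kth_zero (CRR (Complex lam \<eta>) n) k - 2 * \<eta> / ?l"
      by (simp add: kth_zero_CRR_laguerre_scaling[OF lam elim(2) card assms(2,3)] h_def algebra_simps)
    finally show ?case unfolding h_def .
  qed
  then show "powers_from 1 (\<lambda>\<eta>. 1 / \<eta>) at_top (\<lambda>\<eta>. kth_zero (CRR (Complex lam \<eta>) n) k - 2 * \<eta> / ?l)"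
    unfolding powers_from_def by blast
qed

end
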